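(* The space $(\Delta(L^1(\mathbb{R}),\star_c),\tau^* )$ is homeomorphic to $\mathbb{R}_+\cup\{0\}=[0,\infty)$.
   Context: $L^1(\mathbb{R})$ is the space of complex-valued Lebesgue integrable functions on $\mathbb{R}$ (modulo a.e. equality). The cosine convolution of $f,g\in L^1(\mathbb{R})$ is $$f\star_c g(x) := \int_{\mathbb{R}} f(y)\cdot\frac{g(x+y)+g(x-y)}{2}\,dy,$$ which is finite for almost every $x$ and makes $L^1(\mathbb{R})$ a (not necessarily commutative) Banach algebra. $\Delta(L^1(\mathbb{R}),\star_c)$ denotes the set of all nonzero continuous $\mathbb{C}$-linear maps $m:L^1(\mathbb{R})\to\mathbb{C}$ which are multiplicative: $m(f\star_c g)=m(f)m(g)$ for all $f,g\in L^1(\mathbb{R})$. $\tau^*$ is the weak* topology on it (as a subset of the dual of $L^1(\mathbb{R})$). $[0,\infty)$ carries its usual topology. *)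

theory Defs
  imports "HOL-Analysis.Analysis"
begin

definition L1_rel :: "(real \<Rightarrow> complex) \<Rightarrow> (real \<Rightarrow> complex) \<Rightarrow> bool"
  where "L1_rel f g \<longleftrightarrow>
    integrable lebesgue f \<and> integrable lebesgue g \<and> (AE x in lebesgue. f x = g x)"

lemma part_equivp_L1_rel: "part_equivp L1_rel"
proof (rule part_equivpI)
  show "\<exists>f. L1_rel f f"
    by (rule exI[of _ "\<lambda>_. 0"]) (simp add: L1_rel_def)
  show "symp L1_rel"
    by (rule sympI) (auto simp: L1_rel_def elim: eventually_mono)
  show "transp L1_rel"
    by (rule transpI) (auto simp: L1_rel_def elim: eventually_elim2)
qed

(* The quotient by a partial equivalence relation: only integrable functions represent elements. *)
quotient_type L1 = "real \<Rightarrow> complex" / partial: L1_rel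
  by (rule part_equivp_L1_rel)

instantiation L1 :: ab_group_add
begin

lift_definition zero_L1 :: L1 is "\<lambda>_. 0"
  by (simp add: L1_rel_def)

lift_definition plus_L1 :: "L1 \<Rightarrow> L1 \<Rightarrow> L1" is "\<lambda>f g x. f x + g x"
  by (auto simp: L1_rel_def elim: eventually_elim2)

lift_definition minus_L1 :: "L1 \<Rightarrow> L1 \<Rightarrow> L1" is "\<lambda>f g x. f x - g x"
  by (auto simp: L1_rel_def elim: eventually_elim2)

lift_definition uminus_L1 :: "L1 \<Rightarrow> L1" is "\<lambda>f x. - f x"
  by (auto simp: L1_rel_def elim: eventually_mono)

instance
proof
  fix a b c :: L1
  show "a + b + c = a + (b + c)"
    by transfer (auto simp: L1_rel_def add.assoc)
  show "a + b = b + a"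
    by transfer (auto simp: L1_rel_def add.commute)
  show "0 + a = a"
    by transfer (auto simp: L1_rel_def)
  show "- a + a = 0"
    by transfer (auto simp: L1_rel_def)
  show "a - b = a + - b"
    by transfer (auto simp: L1_rel_def)
qed

end

lift_definition scaleC_L1 :: "complex \<Rightarrow> L1 \<Rightarrow> L1" is "\<lambda>c f x. c * f x"
  by (auto simp: L1_rel_def elim: eventually_mono)

lemma vector_space_scaleC_L1: "vector_space scaleC_L1"
  by unfold_locales (transfer; auto simp: L1_rel_def algebra_simps)+

instantiation L1 :: real_vector
begin

lift_definition scaleR_L1 :: "real \<Rightarrow> L1 \<Rightarrow> L1" is "\<lambda>r f x. r *\<^sub>R f x"
  by (auto simp: L1_rel_def elim: eventually_mono)

instance
proof
  fix f g :: L1 and r s :: real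
  show "r *\<^sub>R (f + g) = r *\<^sub>R f + r *\<^sub>R g"
    by transfer (auto simp: L1_rel_def algebra_simps)
  show "(r + s) *\<^sub>R f = r *\<^sub>R f + s *\<^sub>R f"
    by transfer (auto simp: L1_rel_def algebra_simps)
  show "r *\<^sub>R s *\<^sub>R f = (r * s) *\<^sub>R f"
    by transfer (auto simp: L1_rel_def)
  show "1 *\<^sub>R f = f"
    by transfer (auto simp: L1_rel_def)
qed

end

instantiation L1 :: real_normed_vector
begin

lift_definition norm_L1 :: "L1 \<Rightarrow> real" is "\<lambda>f. LINT x|lebesgue. cmod (f x)"
  by (rule integral_cong_AE) (auto simp: L1_rel_def elim: eventually_mono)

definition sgn_L1 :: "L1 \<Rightarrow> L1"
  where "sgn_L1 f = f /\<^sub>R norm f"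

definition dist_L1 :: "L1 \<Rightarrow> L1 \<Rightarrow> real"
  where "dist_L1 f g = norm (f - g)"

definition uniformity_L1 :: "(L1 \<times> L1) filter"
  where "uniformity_L1 = (INF e\<in>{0<..}. principal {(f, g). dist f g < e})"

definition open_L1 :: "L1 set \<Rightarrow> bool"
  where "open_L1 U \<longleftrightarrow> (\<forall>f\<in>U. \<forall>\<^sub>F (f', g) in uniformity. f' = f \<longrightarrow> g \<in> U)"

instance
proof
  fix f g :: L1 and r :: real and U :: "L1 set"
  show "dist f g = norm (f - g)"
    by (rule dist_L1_def)
  show "sgn f = f /\<^sub>R norm f"
    by (rule sgn_L1_def)
  show "uniformity = (INF e\<in>{0<..}. principal {(f, g :: L1). dist f g < e})"
    by (rule uniformity_L1_def)
  show "open U \<longleftrightarrow> (\<forall>f\<in>U. \<forall>\<^sub>F (f', g) in uniformity. f' = f \<longrightarrow> g \<in> U)"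
    by (rule open_L1_def)
  show "norm f = 0 \<longleftrightarrow> f = 0"
  proof transfer
    fix f :: "real \<Rightarrow> complex"
    assume "L1_rel f f"
    then have f: "integrable lebesgue f"
      by (simp add: L1_rel_def)
    have "(LINT x|lebesgue. cmod (f x)) = 0 \<longleftrightarrow> (AE x in lebesgue. cmod (f x) = 0)"
      by (rule integral_nonneg_eq_0_iff_AE) (use f in auto)
    then show "(LINT x|lebesgue. cmod (f x)) = 0 \<longleftrightarrow> L1_rel f (\<lambda>_. 0)"
      using f by (simp add: L1_rel_def)
  qed
  show "norm (f + g) \<le> norm f + norm g"
  proof transfer
    fix f g :: "real \<Rightarrow> complex"
    assume "L1_rel f f" "L1_rel g g"
    then have fg: "integrable lebesgue f" "integrable lebesgue g"
      by (simp_all add: L1_rel_def)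
    have "(LINT x|lebesgue. cmod (f x + g x)) \<le> (LINT x|lebesgue. cmod (f x) + cmod (g x))"
      by (rule integral_mono) (use fg in \<open>auto intro: norm_triangle_ineq\<close>)
    then show "(LINT x|lebesgue. cmod (f x + g x)) \<le>
        (LINT x|lebesgue. cmod (f x)) + (LINT x|lebesgue. cmod (g x))"
      using fg by simp
  qed
  show "norm (r *\<^sub>R f) = \<bar>r\<bar> * norm f"
    by transfer simp
qed

end

(* Where the integrand is not integrable in y, the Bochner integral is 0 by convention.  For
   integrable f and g this happens only for x in a null set, hence is invisible in L1. *)
definition cosine_conv_fun :: "(real \<Rightarrow> complex) \<Rightarrow> (real \<Rightarrow> complex) \<Rightarrow> real \<Rightarrow> complex"
  where "cosine_conv_fun f g x = (LINT y|lebesgue. f y * ((g (x + y) + g (x - y)) / 2))"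

lemma AE_lebesgue_affine:
  fixes P :: "real \<Rightarrow> bool"
  assumes "AE x in lebesgue. P x" and c: "c \<noteq> 0"
  shows "AE x in lebesgue. P (t + c * x)"
proof -
  obtain N where N: "{x. \<not> P x} \<subseteq> N" "N \<in> null_sets lborel"
    using assms(1)[unfolded AE_completion_iff] unfolding eventually_ae_filter by auto
  then have *: "(\<integral>\<^sup>+x. indicator N x \<partial>lborel) = (0::ennreal)"
    by (simp add: null_sets_def)
  have [measurable]: "N \<in> sets borel"
    using N by (auto simp: null_sets_def)
  from * c have "(\<integral>\<^sup>+x. indicator N (t + c * x) \<partial>lborel) = (0::ennreal)"
    by (subst (asm) nn_integral_real_affine[OF _ c, of _ t]) auto
  then have "AE x in lborel. indicator N (t + c * x) = (0::ennreal)"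
    by (subst (asm) nn_integral_0_iff_AE) auto
  then have "AE x in lborel. P (t + c * x)"
    by (rule eventually_mono) (use N in \<open>auto simp: indicator_def split: if_splits\<close>)
  then show ?thesis
    by (simp add: AE_completion_iff)
qed

lemma L1_rel_Borel_representative:
  assumes f: "integrable lebesgue f"
  obtains f' where "f' \<in> borel_measurable borel" "integrable lborel f'" "L1_rel f f'"
proof -
  have meas: "(\<lambda>x. Re (f x)) \<in> borel_measurable lebesgue" "(\<lambda>x. Im (f x)) \<in> borel_measurable lebesgue"
    using f by auto
  obtain u v where uv [measurable]: "u \<in> borel_measurable lborel" "v \<in> borel_measurable lborel"
    and ae: "AE x in lborel. Re (f x) = u x" "AE x in lborel. Im (f x) = v x"
    using meas[THEN completion_ex_borel_measurable_real] by blast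
  define f' where "f' x = Complex (u x) (v x)" for x
  have "f' = (\<lambda>x. of_real (u x) + \<i> * of_real (v x))"
    by (simp add: f'_def complex_eq_iff fun_eq_iff)
  then have f' [measurable]: "f' \<in> borel_measurable borel"
    by simp
  have "AE x in lebesgue. f x = f' x"
    unfolding AE_completion_iff using ae
    by eventually_elim (simp add: f'_def complex_eq_iff)
  moreover from this have "integrable lebesgue f'"
    by (subst integrable_cong_AE[where g = f])
       (use f in \<open>auto elim: eventually_mono intro: measurable_completion\<close>)
  ultimately show thesis
    using that[of f'] f f' by (auto simp: L1_rel_def integrable_completion)
qed

lemma cosine_conv_fun_cong:
  assumes "L1_rel f f'" "L1_rel g g'"
  shows "cosine_conv_fun f g = cosine_conv_fun f' g'"
proof
  fix x
  have int: "integrable lebesgue f" "integrable lebesgue f'" "integrable lebesgue g" "integrable lebesgue g'"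
    and f: "AE y in lebesgue. f y = f' y" and g: "AE y in lebesgue. g y = g' y"
    using assms by (auto simp: L1_rel_def)
  have shift: "(\<lambda>y. h (x + y)) \<in> borel_measurable lebesgue" "(\<lambda>y. h (x - y)) \<in> borel_measurable lebesgue"
    if "integrable lebesgue h" for h :: "real \<Rightarrow> complex"
    using lebesgue_integrable_real_affine[OF that, of 1 x] lebesgue_integrable_real_affine[OF that, of "-1" x]
    by (auto dest: borel_measurable_integrable)
  have ae: "AE y in lebesgue. g (x + y) = g' (x + y)" "AE y in lebesgue. g (x - y) = g' (x - y)"
    using AE_lebesgue_affine[OF g, of 1 x] AE_lebesgue_affine[OF g, of "-1" x] by simp_all
  show "cosine_conv_fun f g x = cosine_conv_fun f' g' x"
    unfolding cosine_conv_fun_def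
  proof (rule integral_cong_AE)
    show "AE y in lebesgue. f y * ((g (x + y) + g (x - y)) / 2) = f' y * ((g' (x + y) + g' (x - y)) / 2)"
      using f ae by eventually_elim simp
  qed (use int shift in \<open>auto intro!: borel_measurable_times borel_measurable_add borel_measurable_divide\<close>)
qed

lemma integrable_cosine_conv_fun:
  assumes f: "integrable lebesgue f" and g: "integrable lebesgue g"
  shows "integrable lebesgue (cosine_conv_fun f g)"
proof -
  obtain f' where f' [measurable]: "f' \<in> borel_measurable borel" and intf: "integrable lborel f'" and ff': "L1_rel f f'"
    using L1_rel_Borel_representative[OF f] .
  obtain g' where g' [measurable]: "g' \<in> borel_measurable borel" and intg: "integrable lborel g'" and gg': "L1_rel g g'"
    using L1_rel_Borel_representative[OF g] .
  have prod: "integrable (lborel \<Otimes>\<^sub>M lborel) (\<lambda>(y, x). f' y * g' (x + s * y))" for s :: real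
  proof (rule lborel_pair.Fubini_integrable)
    have affine: "integrable lborel (\<lambda>x. g' (x + s * y))" for y
      using lborel_integrable_real_affine[OF intg, of 1 "s * y"] by (simp add: add.commute)
    have "(LINT x|lborel. cmod (g' (x + s * y))) = (LINT x|lborel. cmod (g' x))" for y
      using lborel_integral_real_affine[of 1 "\<lambda>x. cmod (g' x)" "s * y"] by (simp add: add.commute)
    then show "integrable lborel (\<lambda>y. LINT x|lborel. norm (case (y, x) of (y, x) \<Rightarrow> f' y * g' (x + s * y)))"
      using intf by (simp add: norm_mult)
    show "AE y in lborel. integrable lborel (\<lambda>x. case (y, x) of (y, x) \<Rightarrow> f' y * g' (x + s * y))"
      using affine by simp
  qed measurable
  have "integrable (lborel \<Otimes>\<^sub>M lborel) (\<lambda>(y, x). f' y * ((g' (x + y) + g' (x - y)) / 2))"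
    using integrable_divide_zero[OF Bochner_Integration.integrable_add[OF prod[of 1] prod[of "-1"]], of 2]
    by (simp add: case_prod_beta' algebra_simps add_divide_distrib)
  then have int: "integrable lborel (\<lambda>x. LINT y|lborel. f' y * ((g' (x + y) + g' (x - y)) / 2))"
    by (rule lborel_pair.integrable_snd)
  have "cosine_conv_fun f g = (\<lambda>x. LINT y|lborel. f' y * ((g' (x + y) + g' (x - y)) / 2))"
    unfolding cosine_conv_fun_cong[OF ff' gg'] cosine_conv_fun_def
    by (intro ext integral_completion) measurable
  with int show ?thesis
    using integrable_completion[OF borel_measurable_integrable[OF int]] by simp
qed

lift_definition cosine_conv :: "L1 \<Rightarrow> L1 \<Rightarrow> L1" (infixl \<open>\<star>\<^sub>c\<close> 70) is cosine_conv_fun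
proof -
  fix f f' g g'
  assume "L1_rel f f'" "L1_rel g g'"
  then show "L1_rel (cosine_conv_fun f g) (cosine_conv_fun f' g')"
    using cosine_conv_fun_cong[of f f' g g'] integrable_cosine_conv_fun by (simp add: L1_rel_def)
qed

definition L1_dual :: "(L1 \<Rightarrow> complex) set"
  where "L1_dual = {m. Vector_Spaces.linear scaleC_L1 (*) m \<and> continuous_on UNIV m}"

(* The coarsest topology on the dual that makes every evaluation at an f in L1 continuous. *)
definition L1_weak_star :: "(L1 \<Rightarrow> complex) topology"
  where "L1_weak_star = topology_generated_by {{m \<in> L1_dual. m f \<in> U} | f U. open U}"

lemma topspace_L1_weak_star [simp]: "topspace L1_weak_star = L1_dual"
proof -
  have "L1_dual = {m \<in> L1_dual. m 0 \<in> UNIV}"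
    by simp
  then show ?thesis
    unfolding L1_weak_star_def topology_generated_by_topspace by blast
qed

definition cosine_spectrum :: "(L1 \<Rightarrow> complex) set"
  where "cosine_spectrum =
    {m \<in> L1_dual. m \<noteq> (\<lambda>_. 0) \<and> (\<forall>f g. m (f \<star>\<^sub>c g) = m f * m g)}"

end

theory Submission
  imports Defs
begin

text \<open>
The nonzero multiplicative functionals are exactly the cosine transforms
$m_t(f) = \<integral> f(x) \cos (t x)\, dx$ with $t \<ge> 0$, and $t \mapsto m_t$ is the homeomorphism.

Let $A_y g(x) = (g(x+y) + g(x-y))/2$, so that $f \star_c g = \<integral> f(y)\, A_y g \, dy$. The identity
$m_t(A_y g) = \cos (t y)\, m_t(g)$ and Fubini's theorem make each $m_t$ multiplicative
(\<open>cos_transform_cosine_conv\<close>).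

Conversely, let $m$ be multiplicative and nonzero. Since $A_y f \star_c g = f \star_c A_y g$
(\<open>cosine_conv_sym_shift\<close>), there is a function $\<phi>$ with $m(A_y f) = \<phi>(y)\, m(f)$ for all $f$, and
$A_y A_x = (A_{x+y} + A_{x-y})/2$ makes it a solution of d'Alembert's functional equation
$\<phi>(x+y) + \<phi>(x-y) = 2 \<phi>(x) \<phi>(y)$. It is bounded and continuous, hence $\<phi>(y) = \cos (t y)$
(\<open>bounded_dAlembert_solution_is_cos\<close>). Formally $m(f) m(g) = \<integral> f(y)\, m(A_y g)\, dy$, so $m = m_t$. To avoid
integrating functions with values in $L^1$, the formula is proved only for indicators of intervals
$f = 1_{(c,d]}$, where it amounts to the derivative of $x \mapsto m(1_{(c,x]})$ being $\<phi>$
(\<open>norm_cosine_conv_indicator_approx\<close>); such indicators span a dense subspace (\<open>L1_dual_eq_0\<close>). The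
function $g$, of which only $m(g) \<noteq> 0$ matters, is taken to be an indicator, too, which makes the continuity of $y \mapsto A_y g$ elementary.

The map $t \mapsto m_t$ is weak* continuous by dominated convergence. Its inverse is continuous since $t$ can be
recovered from a single evaluation: for $e(x) = e^{-x}$ on $[0, \<infinity>)$ and $0$ elsewhere,
$m_t(e) = 1/(1 + t^2)$.
\<close>

section \<open>Bounded solutions of d'Alembert's functional equation\<close>

lemma linear_ode_zero_initial_value:
  fixes p :: "real \<Rightarrow> complex"
  assumes deriv: "\<And>x. (p has_vector_derivative z * p x) (at x)" and "p 0 = 0"
  shows "p x = 0"
proof -
  have "((\<lambda>x. p x * exp (- z * of_real x)) has_vector_derivative 0) (at x)" for x
  proof -
    have "((\<lambda>x. exp (- z * of_real x)) has_vector_derivative - z * exp (- z * of_real x)) (at x)"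
      by (rule has_vector_derivative_real_field derivative_eq_intros refl | simp)+
    from has_vector_derivative_mult[OF deriv this] show ?thesis
      by (simp add: algebra_simps)
  qed
  then obtain c where "\<And>x. p x * exp (- z * of_real x) = c"
    using has_vector_derivative_zero_constant[of UNIV] by auto
  from this[of x] this[of 0] show ?thesis
    using \<open>p 0 = 0\<close> by simp
qed

lemma eq_if_derivatives_eq:
  fixes f g :: "real \<Rightarrow> complex"
  assumes "\<And>x. (f has_vector_derivative f' x) (at x)"
    and "\<And>x. (g has_vector_derivative f' x) (at x)"
    and "f 0 = g 0"
  shows "f x = g x"
proof -
  have "((\<lambda>x. f x - g x) has_vector_derivative 0) (at x)" for x
    using has_vector_derivative_diff[OF assms(1,2)] by simp
  then obtain c where "\<And>x. f x - g x = c"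
    using has_vector_derivative_zero_constant[of UNIV] by auto
  from this[of x] this[of 0] show ?thesis
    using assms(3) by simp
qed

lemma has_vector_derivative_shift:
  fixes f :: "real \<Rightarrow> 'a::real_normed_vector"
  assumes "\<And>x. (f has_vector_derivative f' x) (at x)"
  shows "((\<lambda>y. f (x + y)) has_vector_derivative f' (x + y)) (at y)"
    and "((\<lambda>y. f (x - y)) has_vector_derivative - f' (x - y)) (at y)"
    and "((\<lambda>y. f (y + x)) has_vector_derivative f' (y + x)) (at y)"
    and "((\<lambda>y. f (y - x)) has_vector_derivative f' (y - x)) (at y)"
proof -
  have *: "((\<lambda>y. f (a + b * y)) has_vector_derivative b *\<^sub>R f' (a + b * y)) (at y)" for a b
  proof -
    have "((\<lambda>y. a + b * y) has_vector_derivative b) (at y)"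
      by (auto simp: has_real_derivative_iff_has_vector_derivative[symmetric] intro!: derivative_eq_intros)
    from vector_diff_chain_at[OF this assms] show ?thesis
      by (simp add: o_def)
  qed
  show "((\<lambda>y. f (x + y)) has_vector_derivative f' (x + y)) (at y)"
    and "((\<lambda>y. f (x - y)) has_vector_derivative - f' (x - y)) (at y)"
    and "((\<lambda>y. f (y + x)) has_vector_derivative f' (y + x)) (at y)"
    and "((\<lambda>y. f (y - x)) has_vector_derivative f' (y - x)) (at y)"
    using *[of x 1] *[of x "-1"] *[of "-x" 1] by (simp_all add: add.commute)
qed

text \<open>Off the real line the cosine is unbounded: at a point where the exponent has real part $s$, the two
exponentials making up the cosine have absolute values $e^s$ and $e^{-s}$, whose difference exceeds any
bound. The point below is chosen such that $s = 2M + 1$, so that $e^s \<ge> 1 + s$ already gives the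
contradiction.\<close>

lemma bounded_cos_imp_real:
  assumes bounded: "\<And>x::real. cmod (cos (w * of_real x)) \<le> M"
  shows "Im w = 0"
proof (rule ccontr)
  assume "Im w \<noteq> 0"
  define x where "x = - (2 * M + 1) / Im w"
  have "0 \<le> M"
    using bounded[of 0] by simp
  have Re: "Re (\<i> * (w * of_real x)) = 2 * M + 1"
    using \<open>Im w \<noteq> 0\<close> by (simp add: x_def)
  have "2 * M + 1 + 1 \<le> exp (2 * M + 1)"
    using exp_ge_add_one_self[of "2 * M + 1"] by simp
  moreover have "exp (- (2 * M + 1)) \<le> 1"
    using \<open>0 \<le> M\<close> by simp
  moreover have "exp (2 * M + 1) - exp (- (2 * M + 1)) \<le> cmod (2 * cos (w * of_real x))"
  proof -
    have "cos (w * of_real x) * 2 = exp (\<i> * (w * of_real x)) - - exp (- (\<i> * (w * of_real x)))"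
      by (simp add: cos_exp_eq)
    then show ?thesis
      using norm_triangle_ineq2[of "exp (\<i> * (w * of_real x))" "- exp (- (\<i> * (w * of_real x)))"] Re
      unfolding mult.commute[of 2] by (simp only: norm_exp_eq_Re norm_minus_cancel uminus_complex.sel)
  qed
  moreover have "cmod (2 * cos (w * of_real x)) \<le> 2 * M"
    using bounded[of x] by (simp add: norm_mult)
  ultimately show False
    by linarith
qed

text \<open>Integrating the equation in $y$ expresses $\<phi>$ through its own antiderivative $F$: for any $c$ with
$F(c) \<noteq> F(0)$, it is a multiple of $F(x+c) - F(x-c)$. A continuous solution is therefore
differentiable, and since its derivative $\<psi>$ is again a difference of translates of $\<phi>$, twice so.
Differentiating the equation twice in $y$ at $y = 0$ yields the oscillator equation
$\<phi>'' = \<phi>''(0) \<cdot> \<phi>$ with the initial values of a cosine, so $\<phi>$ is a cosine of some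
complex frequency $w$, and boundedness forces $w$ to be real.\<close>

proposition bounded_dAlembert_solution_is_cos:
  fixes \<phi> :: "real \<Rightarrow> complex"
  assumes cont: "continuous_on UNIV \<phi>"
    and eq: "\<And>x y. \<phi> (x + y) + \<phi> (x - y) = 2 * \<phi> x * \<phi> y"
    and "\<phi> 0 = 1"
    and bounded: "\<And>x. cmod (\<phi> x) \<le> M"
  obtains t :: real where "t \<ge> 0" "\<And>x. \<phi> x = of_real (cos (t * x))"
proof -
  have "\<exists>F. \<forall>x::real. - \<infinity> < ereal x \<longrightarrow> ereal x < \<infinity> \<longrightarrow> (F has_vector_derivative \<phi> x) (at x)"
    by (rule einterval_antiderivative) (use cont in \<open>auto simp: continuous_on_eq_continuous_at\<close>)
  then obtain F where F: "\<And>x. (F has_vector_derivative \<phi> x) (at x)"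
    by auto
  have F_eq: "F (x + y) - F (x - y) = 2 * \<phi> x * (F y - F 0)" for x y
  proof (rule eq_if_derivatives_eq[of "\<lambda>y. F (x + y) - F (x - y)" "\<lambda>y. 2 * \<phi> x * \<phi> y"])
    show "((\<lambda>y. F (x + y) - F (x - y)) has_vector_derivative 2 * \<phi> x * \<phi> y) (at y)" for y
      using has_vector_derivative_diff[OF has_vector_derivative_shift(1)[OF F] has_vector_derivative_shift(2)[OF F], of x x y] eq[of x y] by simp
    show "((\<lambda>y. 2 * \<phi> x * (F y - F 0)) has_vector_derivative 2 * \<phi> x * \<phi> y) (at y)" for y
      by (intro has_vector_derivative_mult_right) (auto intro!: derivative_eq_intros F)
  qed simp
  have "\<exists>c. F c \<noteq> F 0"
  proof (rule ccontr)
    assume "\<not> (\<exists>c. F c \<noteq> F 0)"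
    then have "F = (\<lambda>_. F 0)"
      by auto
    then have "(F has_vector_derivative 0) (at 0)"
      by (metis has_vector_derivative_const)
    with F[of 0] show False
      using vector_derivative_unique_at \<open>\<phi> 0 = 1\<close> by fastforce
  qed
  then obtain c where c: "F c \<noteq> F 0" ..
  define C where "C = 2 * (F c - F 0)"
  have "C \<noteq> 0"
    using c by (simp add: C_def)
  have \<phi>_eq: "\<phi> x = (F (x + c) - F (x - c)) / C" for x
    using F_eq[of x c] c by (simp add: C_def field_simps)
  define \<psi> where "\<psi> x = (\<phi> (x + c) - \<phi> (x - c)) / C" for x
  define \<theta> where "\<theta> x = (\<psi> (x + c) - \<psi> (x - c)) / C" for x
  have d\<phi>: "(\<phi> has_vector_derivative \<psi> x) (at x)" for x
    using has_vector_derivative_divide[OF has_vector_derivative_diff[OF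
        has_vector_derivative_shift(3)[OF F, of c x] has_vector_derivative_shift(4)[OF F, of c x]], of C]
    by (simp add: \<psi>_def flip: \<phi>_eq)
  have d\<psi>: "(\<psi> has_vector_derivative \<theta> x) (at x)" for x
    using has_vector_derivative_divide[OF has_vector_derivative_diff[OF
        has_vector_derivative_shift(3)[OF d\<phi>, of c x] has_vector_derivative_shift(4)[OF d\<phi>, of c x]], of C]
    by (simp add: \<theta>_def flip: \<psi>_def)
  have \<psi>_eq: "\<psi> (x + y) - \<psi> (x - y) = 2 * \<phi> x * \<psi> y" for x y
  proof -
    have "((\<lambda>y. 2 * \<phi> x * \<phi> y) has_vector_derivative \<psi> (x + y) - \<psi> (x - y)) (at y)"
      using has_vector_derivative_add[OF has_vector_derivative_shift(1)[OF d\<phi>] has_vector_derivative_shift(2)[OF d\<phi>], of x x y] by (simp add: eq)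
    then show ?thesis
      using has_vector_derivative_mult_right[OF d\<phi>] vector_derivative_unique_at by blast
  qed
  have \<theta>_eq: "\<theta> (x + y) + \<theta> (x - y) = 2 * \<phi> x * \<theta> y" for x y
  proof -
    have "((\<lambda>y. 2 * \<phi> x * \<psi> y) has_vector_derivative \<theta> (x + y) + \<theta> (x - y)) (at y)"
      using has_vector_derivative_diff[OF has_vector_derivative_shift(1)[OF d\<psi>] has_vector_derivative_shift(2)[OF d\<psi>], of x x y] by (simp add: \<psi>_eq)
    then show ?thesis
      using has_vector_derivative_mult_right[OF d\<psi>] vector_derivative_unique_at by blast
  qed
  define w where "w = csqrt (- \<theta> 0)"
  have "w\<^sup>2 = - \<theta> 0"
    by (simp add: w_def)
  then have \<theta>: "\<theta> x = - (w * w * \<phi> x)" for x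
    using \<theta>_eq[of x 0] by (simp add: power2_eq_square)
  have "\<psi> 0 = 0"
    using \<psi>_eq[of 0 0] \<open>\<phi> 0 = 1\<close> by simp
  \<comment> \<open>Both $z = \pm i w$ turn the oscillator equation for the difference $u$ into the first-order
    equation $(v + z u)' = z (v + z u)$; together they give $v = 0$ also in the case $w = 0$.\<close>
  define u where "u x = \<phi> x - cos (w * of_real x)" for x
  define v where "v x = \<psi> x + w * sin (w * of_real x)" for x
  have cos': "((\<lambda>x. cos (w * of_real x)) has_vector_derivative - (w * sin (w * of_real x))) (at x)"
    and sin': "((\<lambda>x. sin (w * of_real x)) has_vector_derivative w * cos (w * of_real x)) (at x)" for x
    by (rule has_vector_derivative_real_field derivative_eq_intros refl | simp)+
  have du: "(u has_vector_derivative v x) (at x)" for x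
    using has_vector_derivative_diff[OF d\<phi> cos'] unfolding u_def[abs_def] v_def by simp
  have dv: "(v has_vector_derivative - (w * w * u x)) (at x)" for x
    using has_vector_derivative_add[OF d\<psi> has_vector_derivative_mult_right[OF sin', of w]]
    unfolding u_def v_def[abs_def] by (simp add: \<theta> algebra_simps)
  have "v x + z * u x = 0" if z: "z * z = - (w * w)" for z x
  proof (rule linear_ode_zero_initial_value[of "\<lambda>x. v x + z * u x" z])
    have "z * (v y + z * u y) = - (w * w * u y) + z * v y" for y
      by (simp only: distrib_left mult.assoc[symmetric] z) simp
    then show "((\<lambda>x. v x + z * u x) has_vector_derivative z * (v x + z * u x)) (at x)" for x
      using has_vector_derivative_add[OF dv has_vector_derivative_mult_right[OF du, of z]] by simp
  qed (simp add: u_def v_def \<open>\<phi> 0 = 1\<close> \<open>\<psi> 0 = 0\<close>)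
  note first_order = this
  have v0: "v x = 0" for x
  proof -
    have "v x + \<i> * w * u x = 0" "v x + - (\<i> * w) * u x = 0"
      by (rule first_order; simp add: algebra_simps)+
    then have "2 * v x = 0"
      by (simp add: eq_neg_iff_add_eq_0[symmetric])
    then show ?thesis
      by simp
  qed
  have "u x = 0" for x
    by (rule linear_ode_zero_initial_value[of u 0]) (use du v0 in \<open>auto simp: u_def \<open>\<phi> 0 = 1\<close>\<close>)
  then have \<phi>_cos: "\<phi> x = cos (w * of_real x)" for x
    by (simp add: u_def)
  then have "Im w = 0"
    using bounded_cos_imp_real bounded by metis
  then have "w = of_real (Re w)"
    by (simp add: complex_eq_iff)
  then have "\<phi> x = of_real (cos (Re w * x))" for x
    by (metis \<phi>_cos cos_of_real of_real_mult)
  moreover have "cos (Re w * x) = cos (\<bar>Re w\<bar> * x)" for x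
    by (simp add: abs_if)
  ultimately show thesis
    by (intro that[of "\<bar>Re w\<bar>"]) auto
qed

section \<open>Integrable functions and bounded functionals\<close>

lemma L1_rel_lborel: "L1_rel f f" if "integrable lborel f"
  using that integrable_completion[OF borel_measurable_integrable[OF that]] by (simp add: L1_rel_def)

text \<open>Every class is represented by a Borel function, for which Fubini's theorem on the product of
two Borel--Lebesgue measures is available.\<close>

lemma L1_cases:
  obtains f where "integrable lborel f" "F = abs_L1 f"
proof -
  have "L1_rel (rep_L1 F) (rep_L1 F)"
    by (rule Quotient3_rep_reflp[OF Quotient3_L1])
  then obtain f where f: "integrable lborel f" "L1_rel (rep_L1 F) f"
    by (metis L1_rel_def L1_rel_Borel_representative)
  have "F = abs_L1 (rep_L1 F)"
    by (simp add: Quotient3_abs_rep[OF Quotient3_L1])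
  also have "\<dots> = abs_L1 f"
    using f(2) by (rule Quotient3_rel_abs[OF Quotient3_L1])
  finally show thesis
    using that f(1) by blast
qed

lemma abs_L1_add: "integrable lborel f \<Longrightarrow> integrable lborel g \<Longrightarrow> abs_L1 f + abs_L1 g = abs_L1 (\<lambda>x. f x + g x)"
  and abs_L1_diff: "integrable lborel f \<Longrightarrow> integrable lborel g \<Longrightarrow> abs_L1 f - abs_L1 g = abs_L1 (\<lambda>x. f x - g x)"
  and abs_L1_scaleC: "integrable lborel f \<Longrightarrow> scaleC_L1 c (abs_L1 f) = abs_L1 (\<lambda>x. c * f x)"
  by (simp_all add: plus_L1.abs_eq minus_L1.abs_eq scaleC_L1.abs_eq L1_rel_lborel)

lemma norm_abs_L1:
  assumes "integrable lborel f"
  shows "norm (abs_L1 f) = (LINT x|lborel. cmod (f x))"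
  using assms by (simp add: norm_L1.abs_eq L1_rel_lborel integral_completion)

text \<open>Stated with the nonnegative integral so that norms can be bounded with Tonelli's theorem.\<close>

lemma norm_abs_L1_le:
  assumes "integrable lborel f" and "(\<integral>\<^sup>+x. cmod (f x) \<partial>lborel) \<le> ennreal c" and "0 \<le> c"
  shows "norm (abs_L1 f) \<le> c"
proof -
  have "ennreal (norm (abs_L1 f)) = (\<integral>\<^sup>+x. cmod (f x) \<partial>lborel)"
    unfolding norm_abs_L1[OF assms(1)] using assms(1) by (intro nn_integral_eq_integral[symmetric]) auto
  then show ?thesis
    using assms(2,3) by (simp flip: ennreal_le_iff)
qed

lemma abs_L1_dominated_convergence:
  assumes s: "\<And>i. integrable lborel (s i)" and f: "integrable lborel f"
    and w: "integrable lborel (w :: real \<Rightarrow> real)"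
    and lim: "\<And>x. (\<lambda>i. s i x) \<longlonglongrightarrow> f x" and le: "\<And>i x. cmod (s i x) \<le> w x"
  shows "(\<lambda>i. abs_L1 (s i)) \<longlonglongrightarrow> abs_L1 f"
proof -
  have "(\<lambda>i. LINT x|lborel. cmod (s i x - f x)) \<longlonglongrightarrow> (LINT x|(lborel :: real measure). 0)"
  proof (rule integral_dominated_convergence[where w = "\<lambda>x. w x + cmod (f x)" ])
    show "AE x in lborel. (\<lambda>i. cmod (s i x - f x)) \<longlonglongrightarrow> 0"
      using lim by (auto intro!: tendsto_norm_zero simp: LIM_zero_iff)
    show "AE x in lborel. norm (cmod (s i x - f x)) \<le> w x + cmod (f x)" for i
      using le by (auto intro!: AE_I2 order_trans[OF norm_triangle_ineq4] add_right_mono)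
  qed (intro borel_measurable_integrable Bochner_Integration.integrable_add integrable_norm
      Bochner_Integration.integrable_diff s f w integrable_zero)+
  moreover have "norm (abs_L1 (s i) - abs_L1 f) = (LINT x|lborel. cmod (s i x - f x))" for i
    using s f by (simp add: abs_L1_diff norm_abs_L1)
  ultimately have "(\<lambda>i. norm (abs_L1 (s i) - abs_L1 f)) \<longlonglongrightarrow> 0"
    by simp
  then show ?thesis
    by (rule LIM_zero_cancel[OF tendsto_norm_zero_cancel])
qed

lemma scaleR_L1_eq_scaleC: "r *\<^sub>R F = scaleC_L1 (of_real r) F"
  by transfer (simp add: scaleR_conv_of_real L1_rel_def)

lemma L1_dual_linear:
  assumes "m \<in> L1_dual"
  shows L1_dual_add: "m (F + G) = m F + m G"
    and L1_dual_diff: "m (F - G) = m F - m G"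
    and L1_dual_scaleC: "m (scaleC_L1 c F) = c * m F"
    and L1_dual_0: "m 0 = 0"
proof -
  interpret Vector_Spaces.linear scaleC_L1 "(*)" m
    using assms by (simp add: L1_dual_def)
  show "m (F + G) = m F + m G" "m (F - G) = m F - m G" "m (scaleC_L1 c F) = c * m F" "m 0 = 0"
    by (simp_all add: add diff scale)
qed

lemma L1_dual_tendsto:
  assumes "m \<in> L1_dual" and "(F \<longlongrightarrow> G) S"
  shows "((\<lambda>i. m (F i)) \<longlongrightarrow> m G) S"
  using assms continuous_on_tendsto_compose[of UNIV m F G S] by (simp add: L1_dual_def)

lemma L1_dual_limit_eq_0:
  assumes m: "m \<in> L1_dual" and "F \<longlonglongrightarrow> G" and "\<And>n :: nat. m (F n) = 0"
  shows "m G = 0"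
  using L1_dual_tendsto[OF m assms(2)] assms(3) by (simp add: LIMSEQ_const_iff)

lemma L1_dual_bounded:
  assumes m: "m \<in> L1_dual"
  obtains B where "B > 0" "\<And>F. cmod (m F) \<le> B * norm F"
proof -
  have "\<forall>\<^sub>F F in nhds 0. cmod (m F) < 1"
    using L1_dual_tendsto[OF m, of "\<lambda>F. F" 0 "nhds 0"]
    by (auto intro!: order_tendstoD(2)[OF tendsto_norm_zero] simp: L1_dual_0[OF m] filterlim_ident)
  then obtain d where "d > 0" and d: "\<And>F. norm F < d \<Longrightarrow> cmod (m F) < 1"
    unfolding eventually_nhds_metric by auto
  have "cmod (m F) \<le> 2 / d * norm F" for F
  proof (cases "F = 0")
    case False
    define r where "r = d / (2 * norm F)"
    have "r > 0"
      using False \<open>d > 0\<close> by (simp add: r_def)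
    have "norm (r *\<^sub>R F) < d"
      using False \<open>d > 0\<close> by (simp add: r_def)
    then have "r * cmod (m F) < 1"
      using d[of "r *\<^sub>R F"] \<open>r > 0\<close> by (simp add: scaleR_L1_eq_scaleC L1_dual_scaleC[OF m] norm_mult)
    then show ?thesis
      using False \<open>d > 0\<close> by (simp add: r_def field_simps)
  qed (simp add: L1_dual_0[OF m])
  then show thesis
    using \<open>d > 0\<close> by (intro that[of "2 / d"]) auto
qed

text \<open>A bounded complex linear map is in particular a bounded real linear map, which gives its continuity.\<close>

lemma L1_dualI:
  assumes add: "\<And>F G. m (F + G) = m F + m G" and scale: "\<And>c F. m (scaleC_L1 c F) = c * m F"
    and bound: "\<And>F. cmod (m F) \<le> B * norm F"
  shows "m \<in> L1_dual"
proof -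
  interpret L: vector_space scaleC_L1
    by (rule vector_space_scaleC_L1)
  have "Vector_Spaces.linear scaleC_L1 (*) m"
    by unfold_locales (use add scale in \<open>auto simp: algebra_simps\<close>)
  moreover have "bounded_linear m"
    by (rule bounded_linear_intro[where K = B])
       (use add scale bound in \<open>auto simp: scaleR_L1_eq_scaleC scaleR_conv_of_real mult.commute\<close>)
  then have "continuous_on UNIV m"
    by (rule bounded_linear.continuous_on[OF _ continuous_on_id])
  ultimately show ?thesis
    by (simp add: L1_dual_def)
qed

lemma L1_dual_minus:
  assumes "m \<in> L1_dual" "m' \<in> L1_dual"
  shows "(\<lambda>F. m F - m' F) \<in> L1_dual"
proof -
  obtain B B' where B: "\<And>F. cmod (m F) \<le> B * norm F" and B': "\<And>F. cmod (m' F) \<le> B' * norm F"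
    using L1_dual_bounded[OF assms(1)] L1_dual_bounded[OF assms(2)] by metis
  show ?thesis
  proof (rule L1_dualI)
    show "cmod (m F - m' F) \<le> (B + B') * norm F" for F
      using norm_triangle_ineq4[of "m F" "m' F"] B[of F] B'[of F] by (simp add: distrib_right)
  qed (simp_all add: L1_dual_add[OF assms(1)] L1_dual_add[OF assms(2)] L1_dual_scaleC[OF assms(1)]
      L1_dual_scaleC[OF assms(2)] right_diff_distrib)
qed

section \<open>Density of interval indicators\<close>

lemma integrable_indicator_Ioc [simp]: "integrable lborel (indicator {a<..b::real} :: real \<Rightarrow> complex)"
proof (cases "a \<le> b")
  case True
  then show ?thesis
    by (intro integrable_real_indicator[THEN integrable_of_real[where 'a = complex], simplified of_real_indicator]) auto
next
  case False
  then have "(indicator {a<..b} :: real \<Rightarrow> complex) = (\<lambda>_. 0)"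
    by auto
  then show ?thesis
    by simp
qed

text \<open>The sets on which $m$ vanishes form a Dynkin system containing the half-open intervals. Cutting off to a
bounded interval keeps complements integrable and provides the dominating function for countable
unions.\<close>

lemma L1_dual_eq_0_borel:
  assumes m: "m \<in> L1_dual" and Ioc: "\<And>a b. a \<le> b \<Longrightarrow> m (abs_L1 (indicator {a<..b})) = 0"
    and A: "A \<in> sets borel"
  shows "m (abs_L1 (indicator (A \<inter> {-r<..r}))) = 0"
proof -
  have int: "integrable lborel (indicator (A \<inter> {-r<..r}) :: real \<Rightarrow> complex)" if [measurable]: "A \<in> sets borel" for A
    by (rule Bochner_Integration.integrable_bound[OF integrable_indicator_Ioc[of "-r" r]])
       (auto simp: indicator_def)
  have Ioc: "m (abs_L1 (indicator {a<..b})) = 0" for a b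
    using Ioc[of a b] Ioc[of a a] by (cases "a \<le> b") auto
  have gen: "sets borel = sigma_sets UNIV (range (\<lambda>(a, b). {a <.. b::real}))"
    by (subst borel_sigma_sets_Ioc) simp
  have stable: "Int_stable (range (\<lambda>(a, b). {a <.. b::real}))"
    by (auto simp: Int_stable_def)
  have subset: "range (\<lambda>(a, b). {a <.. b::real}) \<subseteq> Pow UNIV"
    by simp
  have "A \<in> sigma_sets UNIV (range (\<lambda>(a, b). {a <.. b::real}))"
    using A by (simp only: gen)
  with stable subset show ?thesis
  proof (induction A rule: sigma_sets_induct_disjoint)
    case (basic A)
    then show ?case
      using Ioc by auto
  next
    case empty
    show ?case
      using Ioc[of 0 0] by (simp only: greaterThanAtMost_empty[OF order_refl] Int_empty_left)
  next
    case (compl A)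
    have "indicator ((UNIV - A) \<inter> {-r<..r}) = (\<lambda>x. indicator {-r<..r} x - indicator (A \<inter> {-r<..r}) x :: complex)"
      by (auto simp: indicator_def)
    then have "abs_L1 (indicator ((UNIV - A) \<inter> {-r<..r})) =
        abs_L1 (indicator {-r<..r}) - abs_L1 (indicator (A \<inter> {-r<..r}))"
      using compl by (simp add: abs_L1_diff int gen)
    then show ?case
      using compl Ioc by (simp add: L1_dual_diff[OF m])
  next
    case (union A)
    have A: "A i \<in> sets borel" for i
      using union gen by auto
    then have UA: "(\<Union>i<n. A i) \<in> sets borel" "(\<Union>i. A i) \<in> sets borel" for n
      by auto
    have 0: "m (abs_L1 (indicator ((\<Union>i<n. A i) \<inter> {-r<..r}))) = 0" for n
    proof (induction n)
      case 0
      show ?case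
        using Ioc[of 0 0]
        by (simp only: greaterThanAtMost_empty[OF order_refl] lessThan_0 UN_empty Int_empty_left)
    next
      case (Suc n)
      have "indicator ((\<Union>i<Suc n. A i) \<inter> {-r<..r}) =
          (\<lambda>x. indicator ((\<Union>i<n. A i) \<inter> {-r<..r}) x + indicator (A n \<inter> {-r<..r}) x :: complex)"
      proof
        fix x
        have "x \<in> A i \<Longrightarrow> i < n \<Longrightarrow> x \<notin> A n" for i
          using union(1) by (metis UNIV_I disjoint_family_on_def disjoint_iff less_irrefl)
        then show "indicator ((\<Union>i<Suc n. A i) \<inter> {-r<..r}) x =
          (indicator ((\<Union>i<n. A i) \<inter> {-r<..r}) x + indicator (A n \<inter> {-r<..r}) x :: complex)"
          by (auto simp: indicator_def lessThan_Suc)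
      qed
      then have "abs_L1 (indicator ((\<Union>i<Suc n. A i) \<inter> {-r<..r})) =
          abs_L1 (indicator ((\<Union>i<n. A i) \<inter> {-r<..r})) + abs_L1 (indicator (A n \<inter> {-r<..r}))"
        by (simp add: abs_L1_add int UA A)
      then show ?case
        using Suc union by (simp add: L1_dual_add[OF m])
    qed
    have "(\<lambda>n. abs_L1 (indicator ((\<Union>i<n. A i) \<inter> {-r<..r}))) \<longlonglongrightarrow> abs_L1 (indicator ((\<Union>i. A i) \<inter> {-r<..r}))"
    proof (rule abs_L1_dominated_convergence)
      show "integrable lborel (indicator {-r<..r} :: real \<Rightarrow> real)"
        by (cases "-r \<le> r") auto
      show "cmod (indicator ((\<Union>i<n. A i) \<inter> {-r<..r}) x) \<le> indicator {-r<..r} x" for n x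
        by (auto simp: indicator_def)
      show "(\<lambda>n. indicator ((\<Union>i<n. A i) \<inter> {-r<..r}) x :: complex) \<longlonglongrightarrow> indicator ((\<Union>i. A i) \<inter> {-r<..r}) x" for x
        using LIMSEQ_indicator_UN[of A x] tendsto_mult_right[of _ "indicator (\<Union>i. A i) x :: complex" sequentially "indicator {-r<..r} x"]
        by (simp add: indicator_inter_arith)
    qed (use int UA in auto)
    from L1_dual_limit_eq_0[OF m this 0] show ?case .
  qed
qed

text \<open>The indicators of half-open intervals span a dense subspace: bounded Borel sets are covered by the
previous lemma, they exhaust every set of finite measure, and integrable functions are dominated limits of
simple ones. Applied to differences, the lemma says that interval indicators determine a functional.\<close>

lemma L1_dual_eq_0:
  assumes m: "m \<in> L1_dual" and Ioc: "\<And>a b. a \<le> b \<Longrightarrow> m (abs_L1 (indicator {a<..b})) = 0"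
  shows "m F = 0"
proof -
  obtain f where f: "integrable lborel f" and F: "F = abs_L1 f"
    using L1_cases[of F] by auto
  from f have "m (abs_L1 f) = 0"
  proof (induction rule: integrable_induct)
    case (base A c)
    then have [measurable]: "A \<in> sets borel" and int: "integrable lborel (indicator A :: real \<Rightarrow> real)"
      by auto
    have int': "integrable lborel (\<lambda>x. indicator (A \<inter> B) x :: complex)" if [measurable]: "B \<in> sets borel" for B
      by (rule Bochner_Integration.integrable_bound[OF int]) (auto simp: indicator_def)
    have "(\<lambda>n. abs_L1 (indicator (A \<inter> {- real n<..real n}))) \<longlonglongrightarrow> abs_L1 (indicator (A \<inter> UNIV))"
    proof (rule abs_L1_dominated_convergence[OF int' int' int])
      show "cmod (indicator (A \<inter> {- real n<..real n}) x) \<le> indicator A x" for n x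
        by (auto simp: indicator_def)
      show "(\<lambda>n. indicator (A \<inter> {- real n<..real n}) x :: complex) \<longlonglongrightarrow> indicator (A \<inter> UNIV) x" for x
      proof (rule tendsto_eventually)
        obtain N where "\<bar>x\<bar> < real N"
          using reals_Archimedean2 by blast
        then show "\<forall>\<^sub>F n in sequentially. indicator (A \<inter> {- real n<..real n}) x = (indicator (A \<inter> UNIV) x :: complex)"
          by (intro eventually_sequentiallyI[of N]) (auto simp: indicator_def)
      qed
    qed auto
    from L1_dual_limit_eq_0[OF m this] have "m (abs_L1 (indicator (A \<inter> UNIV))) = 0"
      using L1_dual_eq_0_borel[OF m Ioc] by simp
    then have "m (abs_L1 (indicator A)) = 0"
      by (simp only: Int_UNIV_right)
    moreover have "abs_L1 (\<lambda>x. indicator A x *\<^sub>R c) = scaleC_L1 c (abs_L1 (indicator A))"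
      using int'[of UNIV] by (subst abs_L1_scaleC) (auto simp: scaleR_conv_of_real mult.commute of_real_indicator)
    ultimately show ?case
      by (simp add: L1_dual_scaleC[OF m])
  next
    case (add f g)
    then show ?case
      by (simp add: L1_dual_add[OF m] flip: abs_L1_add)
  next
    case (lim f s)
    have "(\<lambda>i. abs_L1 (s i)) \<longlonglongrightarrow> abs_L1 f"
      by (rule abs_L1_dominated_convergence[where w = "\<lambda>x. 2 * cmod (f x)"]) (use lim in auto)
    from L1_dual_limit_eq_0[OF m this] show ?case
      using lim by blast
  qed
  then show ?thesis
    by (simp add: F)
qed

section \<open>Symmetrized translations and the cosine convolution\<close>

text \<open>The generalized translation of the cosine convolution: $f \star_c g$ is the superposition of the functions
\<open>sym_shift y g\<close> with weights $f(y)$.\<close>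

definition sym_shift :: "real \<Rightarrow> (real \<Rightarrow> complex) \<Rightarrow> real \<Rightarrow> complex"
  where "sym_shift y f x = (f (x + y) + f (x - y)) / 2"

lemma integrable_shift:
  fixes f :: "real \<Rightarrow> complex"
  assumes "integrable lborel f"
  shows "integrable lborel (\<lambda>x. f (x + y))" "integrable lborel (\<lambda>x. f (x - y))"
  using lborel_integrable_real_affine[OF assms, of 1 y] lborel_integrable_real_affine[OF assms, of 1 "- y"]
  by (simp_all add: add.commute)

lemma integral_shift:
  fixes f :: "real \<Rightarrow> 'a::{banach, second_countable_topology}"
  shows "(LINT x|lborel. f (x + y)) = (LINT x|lborel. f x)"
    and "(LINT x|lborel. f (x - y)) = (LINT x|lborel. f x)"
  using lborel_integral_real_affine[of 1 f y] lborel_integral_real_affine[of 1 f "- y"]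
  by (simp_all add: add.commute)

lemma integrable_sym_shift: "integrable lborel f \<Longrightarrow> integrable lborel (sym_shift y f)"
  unfolding sym_shift_def[abs_def] by (intro integrable_divide Bochner_Integration.integrable_add integrable_shift)

lemma sym_shift_sym_shift:
  "sym_shift y (sym_shift x f) = (\<lambda>u. (sym_shift (x + y) f u + sym_shift (x - y) f u) / 2)"
  by (auto simp: sym_shift_def fun_eq_iff field_simps intro: arg_cong[where f = f])

lemma norm_sym_shift_le:
  assumes "integrable lborel f"
  shows "norm (abs_L1 (sym_shift y f)) \<le> norm (abs_L1 f)"
proof -
  have "(LINT x|lborel. cmod (sym_shift y f x)) \<le> (LINT x|lborel. (cmod (f (x + y)) + cmod (f (x - y))) / 2)"
    using assms integrable_sym_shift[OF assms] integrable_shift[OF assms]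
    by (intro integral_mono) (auto simp: sym_shift_def norm_divide intro: norm_triangle_ineq)
  also have "\<dots> = (LINT x|lborel. cmod (f x))"
    using assms integrable_shift[OF assms] integral_shift[of "\<lambda>x. cmod (f x)"] by simp
  finally show ?thesis
    by (simp add: norm_abs_L1 assms integrable_sym_shift)
qed

lemma cosine_conv_fun_eq:
  assumes "integrable lborel f" "integrable lborel g"
  shows "cosine_conv_fun f g x = (LINT y|lborel. f y * sym_shift y g x)"
proof -
  have [measurable]: "f \<in> borel_measurable borel" "g \<in> borel_measurable borel"
    using assms by auto
  show ?thesis
    unfolding cosine_conv_fun_def sym_shift_def by (rule integral_completion) measurable
qed

lemma integrable_lborel_cosine_conv_fun:
  assumes f: "integrable lborel f" and g: "integrable lborel g"
  shows "integrable lborel (cosine_conv_fun f g)"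
proof -
  have [measurable]: "f \<in> borel_measurable borel" "g \<in> borel_measurable borel"
    using assms by auto
  have "(\<lambda>x. LINT y|lborel. f y * sym_shift y g x) \<in> borel_measurable lborel"
    unfolding sym_shift_def by measurable
  moreover have "integrable lebesgue f" "integrable lebesgue g"
    using f g L1_rel_lborel by (auto simp: L1_rel_def)
  then have "integrable lebesgue (cosine_conv_fun f g)"
    by (rule integrable_cosine_conv_fun)
  ultimately show ?thesis
    by (simp add: cosine_conv_fun_eq[OF assms, abs_def] integrable_completion)
qed

lemma cosine_conv_abs_L1:
  assumes "integrable lborel f" "integrable lborel g"
  shows "abs_L1 f \<star>\<^sub>c abs_L1 g = abs_L1 (cosine_conv_fun f g)"
  using assms by (simp add: cosine_conv.abs_eq L1_rel_lborel)

text \<open>Substituting $z \mapsto z \pm y$ moves the symmetrized translation from one factor to the other.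
Boundedness of $g$ makes both integrals converge at every point and not merely almost everywhere.\<close>

lemma cosine_conv_sym_shift:
  assumes f: "integrable lborel f" and g: "integrable lborel g" and bounded: "\<And>x. cmod (g x) \<le> C"
  shows "abs_L1 (sym_shift y f) \<star>\<^sub>c abs_L1 g = abs_L1 f \<star>\<^sub>c abs_L1 (sym_shift y g)"
proof -
  have [measurable]: "f \<in> borel_measurable borel" "g \<in> borel_measurable borel"
    using assms by auto
  have "(LINT z|lborel. sym_shift y f z * sym_shift z g x) = (LINT z|lborel. f z * sym_shift z (sym_shift y g) x)" for x
  proof -
    define k where "k z = sym_shift z g x" for z
    have [measurable]: "k \<in> borel_measurable borel"
      unfolding k_def sym_shift_def by measurable
    have k: "cmod (k z) \<le> C" for z
    proof -
      have "cmod (g (x + z) + g (x - z)) \<le> C + C"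
        using bounded by (intro order_trans[OF norm_triangle_ineq] add_mono)
      then show ?thesis
        by (simp add: k_def sym_shift_def norm_divide)
    qed
    have int: "integrable lborel (\<lambda>z. h z * k (z + s))" if "integrable lborel h" for h s
    proof (rule Bochner_Integration.integrable_bound[of lborel "\<lambda>z. C * cmod (h z)"])
      have [measurable]: "h \<in> borel_measurable borel"
        using that by auto
      show "(\<lambda>z. h z * k (z + s)) \<in> borel_measurable lborel"
        by measurable
      have "cmod (h z) * cmod (k (z + s)) \<le> C * cmod (h z)" for z
        using mult_right_mono[OF k, of "cmod (h z)" "z + s"] by (simp add: mult.commute)
      then show "AE z in lborel. norm (h z * k (z + s)) \<le> norm (C * cmod (h z))"
        by (auto simp: norm_mult intro: order_trans[OF _ abs_ge_self])
    qed (use that in simp)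
    have "(LINT z|lborel. sym_shift y f z * k z) =
        (LINT z|lborel. f (z + y) * k z) / 2 + (LINT z|lborel. f (z - y) * k z) / 2"
      using int[OF integrable_shift(1)[OF f], of y 0] int[OF integrable_shift(2)[OF f], of y 0]
      by (simp add: sym_shift_def distrib_right add_divide_distrib)
    also have "\<dots> = (LINT z|lborel. f z * k (z + - y)) / 2 + (LINT z|lborel. f z * k (z + y)) / 2"
      using integral_shift(1)[of "\<lambda>z. f z * k (z - y)" y] integral_shift(2)[of "\<lambda>z. f z * k (z + y)" y] by simp
    also have "\<dots> = (LINT z|lborel. f z * ((k (z + - y) + k (z + y)) / 2))"
      using int[OF f, of "- y"] int[OF f, of y] by (simp add: distrib_left add_divide_distrib)
    also have "(\<lambda>z. (k (z + - y) + k (z + y)) / 2) = (\<lambda>z. sym_shift z (sym_shift y g) x)"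
    proof
      fix z
      have args: "x + (z + - y) = x + z - y" "x - (z + - y) = x - z + y"
        "x + (z + y) = x + z + y" "x - (z + y) = x - z - y"
        by simp_all
      show "(k (z + - y) + k (z + y)) / 2 = sym_shift z (sym_shift y g) x"
        unfolding k_def sym_shift_def args by (simp add: add_divide_distrib)
    qed
    finally show ?thesis
      by (simp add: k_def)
  qed
  then have "cosine_conv_fun (sym_shift y f) g = cosine_conv_fun f (sym_shift y g)"
    using f g by (simp add: cosine_conv_fun_eq integrable_sym_shift fun_eq_iff)
  then show ?thesis
    using f g by (simp add: cosine_conv_abs_L1 integrable_sym_shift)
qed

section \<open>Symmetrized translates of interval indicators\<close>

lemma indicator_Ioc_Lipschitz:
  fixes p q :: real
  shows "cmod (indicator {a<..b} p - indicator {a<..b} q) \<le> indicator {min p q..max p q} a + indicator {min p q..max p q} b"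
  by (auto simp: indicator_def)

text \<open>Moving the argument from $y$ to $z$ changes the indicator only where an endpoint of the interval lies
between the two translates. For each endpoint and each of the two translation directions this is an
interval of length $|z - y|$.\<close>

lemma nn_integral_sym_shift_indicator_Lipschitz:
  "(\<integral>\<^sup>+x. cmod (sym_shift z (indicator {a<..b}) x - sym_shift y (indicator {a<..b}) x) \<partial>lborel) \<le> ennreal (2 * \<bar>z - y\<bar>)"
proof -
  define I :: "real \<Rightarrow> complex" where "I = indicator {a<..b}"
  define lo hi where "lo = min z y" and "hi = max z y"
  have "lo \<le> hi" and len: "hi - lo = \<bar>z - y\<bar>"
    by (auto simp: lo_def hi_def)
  have bound: "2 * cmod (sym_shift z I x - sym_shift y I x) \<le>
      indicator {a - hi..a - lo} x + indicator {b - hi..b - lo} x +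
      (indicator {a + lo..a + hi} x + indicator {b + lo..b + hi} x)" for x
  proof -
    have "2 * (sym_shift z I x - sym_shift y I x) = (I (x + z) - I (x + y)) + (I (x - z) - I (x - y))"
      by (simp add: sym_shift_def field_simps)
    then have "2 * cmod (sym_shift z I x - sym_shift y I x) \<le> cmod (I (x + z) - I (x + y)) + cmod (I (x - z) - I (x - y))"
      by (metis norm_mult norm_numeral norm_triangle_ineq)
    also have "cmod (I (x + z) - I (x + y)) \<le> indicator {a - hi..a - lo} x + indicator {b - hi..b - lo} x"
      unfolding I_def by (rule order_trans[OF indicator_Ioc_Lipschitz]) (auto simp: indicator_def lo_def hi_def)
    also have "cmod (I (x - z) - I (x - y)) \<le> indicator {a + lo..a + hi} x + indicator {b + lo..b + hi} x"
      unfolding I_def by (rule order_trans[OF indicator_Ioc_Lipschitz]) (auto simp: indicator_def lo_def hi_def)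
    finally show ?thesis
      by simp
  qed
  define S :: "real \<Rightarrow> real" where "S x =
      (indicator {a - hi..a - lo} x + indicator {b - hi..b - lo} x +
      (indicator {a + lo..a + hi} x + indicator {b + lo..b + hi} x)) / 2" for x
  have S: "has_bochner_integral lborel S (((hi - lo) + (hi - lo) + ((hi - lo) + (hi - lo))) / 2)"
  proof -
    have "has_bochner_integral lborel (indicator {u..v}) (v - u)" if "u \<le> v" for u v :: real
      using that has_bochner_integral_real_indicator[of "{u..v}" lborel] by simp
    from this[of "a - hi" "a - lo"] this[of "b - hi" "b - lo"] this[of "a + lo" "a + hi"] this[of "b + lo" "b + hi"]
    show ?thesis
      using \<open>lo \<le> hi\<close> unfolding S_def[abs_def]
      by (intro has_bochner_integral_divide has_bochner_integral_add) auto
  qed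
  have "(\<integral>\<^sup>+x. cmod (sym_shift z I x - sym_shift y I x) \<partial>lborel) \<le> (\<integral>\<^sup>+x. S x \<partial>lborel)"
  proof (intro nn_integral_mono ennreal_leI)
    show "cmod (sym_shift z I x - sym_shift y I x) \<le> S x" for x
      using bound[of x] unfolding S_def by (subst pos_le_divide_eq) (simp_all only: mult.commute zero_less_numeral)
  qed
  also have "\<dots> = ennreal (2 * \<bar>z - y\<bar>)"
    using S by (subst nn_integral_eq_integral)
      (auto simp: has_bochner_integral_iff len S_def intro!: divide_nonneg_pos add_nonneg_nonneg)
  finally show ?thesis
    by (simp add: I_def)
qed

lemma norm_sym_shift_indicator_Lipschitz:
  "norm (abs_L1 (sym_shift z (indicator {a<..b})) - abs_L1 (sym_shift y (indicator {a<..b}))) \<le> 2 * \<bar>z - y\<bar>"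
  unfolding abs_L1_diff[OF integrable_sym_shift[OF integrable_indicator_Ioc] integrable_sym_shift[OF integrable_indicator_Ioc]]
  by (intro norm_abs_L1_le nn_integral_sym_shift_indicator_Lipschitz Bochner_Integration.integrable_diff
      integrable_sym_shift integrable_indicator_Ioc) simp

text \<open>Convolution with the indicator of a short interval around $y$ is the interval length times the
symmetrized translation by $y$, up to a quadratic error: the difference is the integral over
$z \in (c, d]$ of a function whose norm is at most $2 |z - y|$. This replaces vector-valued
integration in $L^1$.\<close>

lemma norm_cosine_conv_indicator_approx:
  fixes a b c d y :: real
  assumes y: "c \<le> y" "y \<le> d"
  defines "I \<equiv> indicator {a<..b}"
  shows "norm (abs_L1 (indicator {c<..d}) \<star>\<^sub>c abs_L1 I - scaleC_L1 (of_real (d - c)) (abs_L1 (sym_shift y I)))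
    \<le> 2 * (d - c)\<^sup>2"
proof -
  have int_I: "integrable lborel I"
    by (simp add: I_def)
  have [measurable]: "I \<in> borel_measurable borel"
    by (simp add: I_def)
  define h where "h x = cosine_conv_fun (indicator {c<..d}) I x - of_real (d - c) * sym_shift y I x" for x
  have int_h: "integrable lborel h"
    unfolding h_def[abs_def] using int_I
    by (intro Bochner_Integration.integrable_diff integrable_lborel_cosine_conv_fun integrable_mult_right integrable_sym_shift) auto
  have int_z: "integrable lborel (\<lambda>z. indicator {c<..d} z * sym_shift z' I x)"
      "integrable lborel (\<lambda>z. indicator {c<..d} z * sym_shift z I x)" for x z'
    by (rule Bochner_Integration.integrable_bound[OF integrable_indicator_Ioc[of c d]];
        auto simp: indicator_def sym_shift_def I_def)+
  have h_eq: "h x = (LINT z|lborel. indicator {c<..d} z * (sym_shift z I x - sym_shift y I x))" for x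
  proof -
    have "(LINT z|lborel. indicator {c<..d} z * sym_shift y I x) = of_real (d - c) * sym_shift y I x"
    proof -
      have "(LINT z|lborel. indicator {c<..d} z :: complex) = (LINT z|lborel. complex_of_real (indicator {c<..d} z))"
        by (simp add: of_real_indicator)
      also have "\<dots> = of_real (LINT z|lborel. indicator {c<..d} z)"
        by (rule integral_complex_of_real)
      also have "\<dots> = of_real (d - c)"
        using y by simp
      finally show ?thesis
        by simp
    qed
    then show ?thesis
      unfolding h_def using int_z(1)[of y x] int_z(2)[of x]
      by (auto simp: cosine_conv_fun_eq int_I right_diff_distrib)
  qed
  have "(\<integral>\<^sup>+x. cmod (h x) \<partial>lborel) \<le>
      (\<integral>\<^sup>+x. \<integral>\<^sup>+z. indicator {c<..d} z * ennreal (cmod (sym_shift z I x - sym_shift y I x)) \<partial>lborel \<partial>lborel)"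
  proof (rule nn_integral_mono)
    fix x
    have "integrable lborel (\<lambda>z. indicator {c<..d} z * (sym_shift z I x - sym_shift y I x))"
      using int_z(1)[of y x] int_z(2)[of x] by (simp add: right_diff_distrib)
    then have "ennreal (cmod (h x)) \<le> (\<integral>\<^sup>+z. cmod (indicator {c<..d} z * (sym_shift z I x - sym_shift y I x)) \<partial>lborel)"
      unfolding h_eq by (rule integral_norm_bound_ennreal)
    also have "\<dots> = (\<integral>\<^sup>+z. indicator {c<..d} z * ennreal (cmod (sym_shift z I x - sym_shift y I x)) \<partial>lborel)"
      by (intro nn_integral_cong) (auto simp: indicator_def)
    finally show "ennreal (cmod (h x)) \<le> \<dots>" .
  qed
  also have "\<dots> = (\<integral>\<^sup>+z. \<integral>\<^sup>+x. indicator {c<..d} z * ennreal (cmod (sym_shift z I x - sym_shift y I x)) \<partial>lborel \<partial>lborel)"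
    by (rule lborel_pair.Fubini') (unfold sym_shift_def, measurable)
  also have "\<dots> \<le> (\<integral>\<^sup>+z. ennreal (2 * (d - c)) * indicator {c<..d} z \<partial>lborel)"
  proof (rule nn_integral_mono)
    fix z
    show "(\<integral>\<^sup>+x. indicator {c<..d} z * ennreal (cmod (sym_shift z I x - sym_shift y I x)) \<partial>lborel)
        \<le> ennreal (2 * (d - c)) * indicator {c<..d} z"
    proof (cases "z \<in> {c<..d}")
      case True
      then have "\<bar>z - y\<bar> \<le> d - c"
        using y by (intro abs_leI) auto
      then have "2 * \<bar>z - y\<bar> \<le> 2 * (d - c)"
        by (rule mult_left_mono) simp
      then show ?thesis
        using True order_trans[OF nn_integral_sym_shift_indicator_Lipschitz[of z a b y] ennreal_leI]
        by (simp add: I_def)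
    qed simp
  qed
  also have "\<dots> = ennreal (2 * (d - c)\<^sup>2)"
    using y by (simp add: nn_integral_cmult_indicator power2_eq_square flip: ennreal_mult)
  finally have "norm (abs_L1 h) \<le> 2 * (d - c)\<^sup>2"
    by (intro norm_abs_L1_le int_h) auto
  moreover have "abs_L1 (indicator {c<..d}) \<star>\<^sub>c abs_L1 I - scaleC_L1 (of_real (d - c)) (abs_L1 (sym_shift y I)) = abs_L1 h"
    unfolding h_def[abs_def]
    by (simp add: cosine_conv_abs_L1 int_I abs_L1_scaleC abs_L1_diff integrable_sym_shift integrable_lborel_cosine_conv_fun)
  ultimately show ?thesis
    by simp
qed

section \<open>Cosine transforms are characters\<close>

lemma cmod_mult_cos_le: "cmod (z * of_real (cos s)) \<le> cmod z"
  by (simp add: norm_mult mult_left_le)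

lift_definition cos_transform :: "real \<Rightarrow> L1 \<Rightarrow> complex"
  is "\<lambda>t f. LINT x|lebesgue. f x * of_real (cos (t * x))"
proof -
  fix t :: real and f f' :: "real \<Rightarrow> complex"
  assume *: "L1_rel f f'"
  have [measurable]: "(\<lambda>x. complex_of_real (cos (t * x))) \<in> borel_measurable lebesgue"
    by (rule measurable_completion) measurable
  show "(LINT x|lebesgue. f x * of_real (cos (t * x))) = (LINT x|lebesgue. f' x * of_real (cos (t * x)))"
    using * by (intro integral_cong_AE) (auto simp: L1_rel_def elim: eventually_mono)
qed

lemma integrable_mult_cos:
  fixes f :: "real \<Rightarrow> complex"
  assumes f: "integrable lborel f"
  shows "integrable lborel (\<lambda>x. f x * of_real (cos (t * x)))"
proof (rule Bochner_Integration.integrable_bound[OF f])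
  have [measurable]: "f \<in> borel_measurable borel"
    using f by auto
  show "(\<lambda>x. f x * of_real (cos (t * x))) \<in> borel_measurable lborel"
    by measurable
  show "AE x in lborel. norm (f x * of_real (cos (t * x))) \<le> norm (f x)"
    using cmod_mult_cos_le by (intro AE_I2)
qed

lemma cos_transform_abs_L1:
  assumes f: "integrable lborel f"
  shows "cos_transform t (abs_L1 f) = (LINT x|lborel. f x * of_real (cos (t * x)))"
  using integrable_mult_cos[OF f, of t] f
  by (simp add: cos_transform.abs_eq L1_rel_lborel integral_completion)

lemma cos_transform_in_L1_dual: "cos_transform t \<in> L1_dual"
proof (rule L1_dualI)
  fix F G :: L1 and c :: complex
  obtain f where f: "integrable lborel f" "F = abs_L1 f"
    using L1_cases[of F] by auto
  obtain g where g: "integrable lborel g" "G = abs_L1 g"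
    using L1_cases[of G] by auto
  show "cos_transform t (F + G) = cos_transform t F + cos_transform t G"
    using f g integrable_mult_cos[OF f(1), of t] integrable_mult_cos[OF g(1), of t]
    by (simp add: abs_L1_add cos_transform_abs_L1 distrib_right)
  show "cos_transform t (scaleC_L1 c F) = c * cos_transform t F"
    using f integrable_mult_cos[OF f(1), of t]
    by (simp add: abs_L1_scaleC cos_transform_abs_L1 mult.assoc)
  have "cmod (LINT x|lborel. f x * of_real (cos (t * x))) \<le> (LINT x|lborel. cmod (f x))"
    using f(1) integrable_mult_cos[OF f(1), of t]
    by (intro order_trans[OF integral_norm_bound] integral_mono integrable_norm cmod_mult_cos_le)
  then show "cmod (cos_transform t F) \<le> 1 * norm F"
    using f by (simp add: cos_transform_abs_L1 norm_abs_L1)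
qed

text \<open>The functional equation $\cos(s - r) + \cos(s + r) = 2 \cos r \cos s$ in transformed form.\<close>

lemma cos_transform_sym_shift:
  assumes f: "integrable lborel f"
  shows "cos_transform t (abs_L1 (sym_shift y f)) = of_real (cos (t * y)) * cos_transform t (abs_L1 f)"
proof -
  have int: "integrable lborel (\<lambda>x. f x * of_real (cos (t * (x + s))))" for s
    using integrable_shift(2)[OF integrable_mult_cos[OF integrable_shift(1)[OF f, of "- s"], of t], of "- s"]
    by simp
  have int': "integrable lborel (\<lambda>x. f (x + s) * of_real (cos (t * x)))" for s
    by (rule integrable_mult_cos[OF integrable_shift(1)[OF f]])
  have shift: "(LINT x|lborel. f (x + s) * of_real (cos (t * x))) = (LINT x|lborel. f x * of_real (cos (t * (x + - s))))" for s
    using integral_shift(1)[of "\<lambda>x. f x * of_real (cos (t * (x + - s)))" s] by simp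
  have "cos_transform t (abs_L1 (sym_shift y f)) =
      ((LINT x|lborel. f (x + y) * of_real (cos (t * x))) + (LINT x|lborel. f (x + - y) * of_real (cos (t * x)))) / 2"
    using int'[of y] int'[of "- y"]
    by (simp add: cos_transform_abs_L1 integrable_sym_shift[OF f] sym_shift_def distrib_right add_divide_distrib)
  also have "\<dots> = (LINT x|lborel. f x * (of_real (cos (t * (x + - y)) + cos (t * (x + y))) / 2))"
    unfolding shift using int[of y] int[of "- y"] by (simp add: distrib_left add_divide_distrib)
  also have "\<dots> = (LINT x|lborel. of_real (cos (t * y)) * (f x * of_real (cos (t * x))))"
  proof (rule arg_cong[where f = "integral\<^sup>L lborel"], rule ext)
    fix x
    have "cos (t * (x + - y)) + cos (t * (x + y)) = 2 * cos (t * y) * cos (t * x)"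
      by (simp add: distrib_left right_diff_distrib cos_add cos_diff)
    then show "f x * (of_real (cos (t * (x + - y)) + cos (t * (x + y))) / 2) = of_real (cos (t * y)) * (f x * of_real (cos (t * x)))"
      by (simp only: of_real_mult) simp
  qed
  also have "\<dots> = of_real (cos (t * y)) * cos_transform t (abs_L1 f)"
    using f by (simp add: cos_transform_abs_L1)
  finally show ?thesis .
qed

text \<open>Exchanging the order of integration, the inner integral is the transform of a symmetrized
translate of $g$, which is $\cos (t y)$ times the transform of $g$.\<close>

lemma cos_transform_cosine_conv:
  "cos_transform t (F \<star>\<^sub>c G) = cos_transform t F * cos_transform t G"
proof -
  obtain f where f: "integrable lborel f" "F = abs_L1 f"
    using L1_cases[of F] by auto
  obtain g where g: "integrable lborel g" "G = abs_L1 g"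
    using L1_cases[of G] by auto
  have [measurable]: "f \<in> borel_measurable borel" "g \<in> borel_measurable borel"
    using f(1) g(1) by auto
  define h where "h y x = f y * sym_shift y g x * of_real (cos (t * x))" for y x
  have [measurable]: "case_prod h \<in> borel_measurable (lborel \<Otimes>\<^sub>M lborel)"
    unfolding h_def sym_shift_def by measurable
  have int_h: "integrable lborel (h y)" for y
    unfolding h_def[abs_def] mult.assoc
    by (intro integrable_mult_right integrable_mult_cos integrable_sym_shift g(1))
  have "integrable (lborel \<Otimes>\<^sub>M lborel) (case_prod h)"
  proof (rule lborel_pair.Fubini_integrable)
    show "integrable lborel (\<lambda>y. LINT x|lborel. norm (case (y, x) of (y, x) \<Rightarrow> h y x))"
    proof (rule Bochner_Integration.integrable_bound[where f = "\<lambda>y. norm G * cmod (f y)"])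
      show "(\<lambda>y. LINT x|lborel. norm (case (y, x) of (y, x) \<Rightarrow> h y x)) \<in> borel_measurable lborel"
        by measurable
      have "(LINT x|lborel. cmod (h y x)) \<le> norm G * cmod (f y)" for y
      proof -
        have "(LINT x|lborel. cmod (h y x)) \<le> (LINT x|lborel. cmod (f y) * cmod (sym_shift y g x))"
        proof (rule integral_mono)
          show "cmod (h y x) \<le> cmod (f y) * cmod (sym_shift y g x)" for x
            unfolding h_def norm_mult[symmetric] by (rule cmod_mult_cos_le)
        qed (use int_h integrable_sym_shift[OF g(1)] in auto)
        also have "\<dots> = cmod (f y) * norm (abs_L1 (sym_shift y g))"
          by (simp add: norm_abs_L1 integrable_sym_shift[OF g(1)])
        also have "\<dots> \<le> cmod (f y) * norm G"
          using norm_sym_shift_le[OF g(1)] by (simp add: g(2) mult_left_mono)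
        finally show ?thesis
          by (simp add: mult.commute)
      qed
      then show "AE y in lborel. norm (LINT x|lborel. norm (case (y, x) of (y, x) \<Rightarrow> h y x)) \<le> norm (norm G * cmod (f y))"
        by (auto intro!: AE_I2 order_trans[OF _ abs_ge_self] simp: abs_of_nonneg integral_nonneg_AE)
    qed (use f in auto)
    show "AE y in lborel. integrable lborel (\<lambda>x. case (y, x) of (y, x) \<Rightarrow> h y x)"
      using int_h by simp
  qed measurable
  then have "(LINT x|lborel. LINT y|lborel. h y x) = (LINT y|lborel. LINT x|lborel. h y x)"
    by (rule lborel_pair.Fubini_integral)
  moreover have "(LINT x|lborel. LINT y|lborel. h y x) = cos_transform t (F \<star>\<^sub>c G)"
    using f g integrable_lborel_cosine_conv_fun[OF f(1) g(1)]
    by (simp add: cosine_conv_abs_L1 cos_transform_abs_L1 cosine_conv_fun_eq h_def)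
  moreover have "(LINT x|lborel. h y x) = (f y * of_real (cos (t * y))) * cos_transform t G" for y
  proof -
    have "(LINT x|lborel. h y x) = f y * cos_transform t (abs_L1 (sym_shift y g))"
      by (simp add: h_def mult.assoc cos_transform_abs_L1 integrable_sym_shift[OF g(1)])
    then show ?thesis
      by (simp add: cos_transform_sym_shift[OF g(1)] g(2))
  qed
  ultimately show ?thesis
    using f by (simp add: cos_transform_abs_L1)
qed

text \<open>A test function whose transform $1/(1 + t^2)$ determines $t \<ge> 0$ and depends on it through an
explicitly invertible continuous function. It makes the parametrization injective, with a weak* continuous
inverse.\<close>

definition one_sided_exp :: L1
  where "one_sided_exp = abs_L1 (\<lambda>x. of_real (indicator {0..} x * exp (- x)))"

lemma integrable_one_sided_exp: "integrable lborel (\<lambda>x::real. indicator {0..} x * exp (- x) :: real)"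
proof -
  have "(\<integral>\<^sup>+x. ennreal (exp (- x)) * indicator {0..} x \<partial>lborel) = ennreal (0 - - exp (- 0 :: real))"
  proof (rule nn_integral_FTC_atLeast)
    show "((\<lambda>x::real. - exp (- x)) \<longlongrightarrow> 0) at_top"
      using tendsto_minus[OF filterlim_compose[OF exp_at_bot filterlim_uminus_at_bot_at_top]] by simp
  qed (auto intro!: derivative_eq_intros)
  moreover have "ennreal (exp (- x)) * indicator {0..} x = ennreal (norm (indicator {0..} x * exp (- x)))" for x :: real
    by (auto simp: indicator_def)
  ultimately show ?thesis
    by (intro integrableI_bounded) auto
qed

lemma cos_transform_one_sided_exp: "cos_transform t one_sided_exp = of_real (1 / (1 + t\<^sup>2))"
proof -
  \<comment> \<open>An antiderivative of $e^{-x} \cos (t x)$.\<close>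
  define F where "F x = exp (- x) * (t * sin (t * x) - cos (t * x)) / (1 + t\<^sup>2)" for x
  have pos: "1 + t\<^sup>2 > 0"
    by (simp add: add_pos_nonneg)
  have F: "(LINT x|lborel. indicator {0..real n} x *\<^sub>R (exp (- x) * cos (t * x))) = F (real n) - F 0" for n
  proof (rule integral_FTC_atLeastAtMost)
    show "(F has_vector_derivative exp (- x) * cos (t * x)) (at x within {0..real n})" for x
    proof -
      have "((\<lambda>x. exp (- x) * (t * sin (t * x) - cos (t * x))) has_real_derivative
          exp (- x) * (t * (t * cos (t * x)) + t * sin (t * x)) - exp (- x) * (t * sin (t * x) - cos (t * x))) (at x)"
        by (auto intro!: derivative_eq_intros simp: algebra_simps)
      from DERIV_cdivide[OF this, of "1 + t\<^sup>2"]
      have "(F has_real_derivative (exp (- x) * (t * (t * cos (t * x)) + t * sin (t * x)) - exp (- x) * (t * sin (t * x) - cos (t * x))) / (1 + t\<^sup>2)) (at x)"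
        unfolding F_def[abs_def] .
      also have "(exp (- x) * (t * (t * cos (t * x)) + t * sin (t * x)) - exp (- x) * (t * sin (t * x) - cos (t * x))) / (1 + t\<^sup>2) = exp (- x) * cos (t * x)"
        using pos by (simp add: field_simps power2_eq_square)
      finally show ?thesis
        by (simp add: has_real_derivative_iff_has_vector_derivative has_vector_derivative_at_within)
    qed
  qed (auto intro!: continuous_intros)
  have F_lim: "(\<lambda>n. F (real n)) \<longlonglongrightarrow> 0"
  proof (rule Lim_null_comparison)
    have "\<bar>t * sin (t * x) - cos (t * x)\<bar> \<le> \<bar>t\<bar> + 1" for x
      using abs_triangle_ineq4[of "t * sin (t * x)" "cos (t * x)"] abs_cos_le_one[of "t * x"]
        mult_left_le[OF abs_sin_le_one abs_ge_zero, of t "t * x"] unfolding abs_mult by linarith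
    then have "\<bar>F x\<bar> \<le> exp (- x) * ((\<bar>t\<bar> + 1) / (1 + t\<^sup>2))" for x
      using pos by (simp add: F_def abs_mult divide_right_mono)
    then show "\<forall>\<^sub>F n in sequentially. norm (F (real n)) \<le> exp (- real n) * ((\<bar>t\<bar> + 1) / (1 + t\<^sup>2))"
      by simp
    have "(\<lambda>n. exp (- real n)) \<longlonglongrightarrow> 0"
      by (rule filterlim_compose[OF exp_at_bot]) (intro filterlim_compose[OF filterlim_uminus_at_bot_at_top] filterlim_real_sequentially)
    then show "(\<lambda>n. exp (- real n) * ((\<bar>t\<bar> + 1) / (1 + t\<^sup>2))) \<longlonglongrightarrow> 0"
      using tendsto_mult_left_zero by blast
  qed
  have "(\<lambda>n. LINT x|lborel. indicator {0..real n} x *\<^sub>R (exp (- x) * cos (t * x))) \<longlonglongrightarrow>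
      (LINT x|lborel. indicator {0..} x * exp (- x) * cos (t * x))"
  proof (rule integral_dominated_convergence[OF _ _ integrable_one_sided_exp])
    show "AE x in lborel. (\<lambda>n. indicator {0..real n} x *\<^sub>R (exp (- x) * cos (t * x))) \<longlonglongrightarrow> indicator {0..} x * exp (- x) * cos (t * x)"
    proof (intro AE_I2 tendsto_eventually)
      fix x :: real
      obtain N where "\<bar>x\<bar> < real N"
        using reals_Archimedean2 by blast
      then show "\<forall>\<^sub>F n in sequentially. indicator {0..real n} x *\<^sub>R (exp (- x) * cos (t * x)) = indicator {0..} x * exp (- x) * cos (t * x)"
        by (intro eventually_sequentiallyI[of N]) (auto simp: indicator_def)
    qed
    show "AE x in lborel. norm (indicator {0..real n} x *\<^sub>R (exp (- x) * cos (t * x))) \<le> indicator {0..} x * exp (- x)" for n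
      by (auto simp: indicator_def abs_mult intro: mult_left_le)
  qed auto
  then have "(\<lambda>n. F (real n) - F 0) \<longlonglongrightarrow> (LINT x|lborel. indicator {0..} x * exp (- x) * cos (t * x))"
    by (simp only: F)
  moreover have "(\<lambda>n. F (real n) - F 0) \<longlonglongrightarrow> 0 - F 0"
    by (intro tendsto_diff F_lim tendsto_const)
  ultimately have "(LINT x|lborel. indicator {0..} x * exp (- x) * cos (t * x)) = 1 / (1 + t\<^sup>2)"
    using LIMSEQ_unique by (fastforce simp: F_def)
  moreover have "cos_transform t one_sided_exp = (LINT x|lborel. complex_of_real (indicator {0..} x * exp (- x) * cos (t * x)))"
    unfolding one_sided_exp_def cos_transform_abs_L1[OF integrable_of_real[OF integrable_one_sided_exp]]
    by simp
  ultimately show ?thesis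
    by (simp only: integral_complex_of_real)
qed

lemma cos_transform_in_cosine_spectrum: "cos_transform t \<in> cosine_spectrum"
proof -
  have "1 + t\<^sup>2 \<noteq> 0"
    by (metis add_pos_nonneg less_irrefl zero_le_power2 zero_less_one)
  then have "cos_transform t one_sided_exp \<noteq> 0"
    unfolding cos_transform_one_sided_exp of_real_eq_0_iff by simp
  then show ?thesis
    by (auto simp: cosine_spectrum_def cos_transform_in_L1_dual cos_transform_cosine_conv)
qed

lemma isCont_cos_transform: "isCont (\<lambda>t. cos_transform t F) t"
proof -
  obtain f where f: "integrable lborel f" "F = abs_L1 f"
    using L1_cases[of F] by auto
  have [measurable]: "f \<in> borel_measurable borel"
    using f(1) by auto
  show ?thesis
    unfolding continuous_at_sequentially o_def f(2) cos_transform_abs_L1[OF f(1)]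
  proof (intro allI impI)
    fix s :: "nat \<Rightarrow> real"
    assume s: "s \<longlonglongrightarrow> t"
    show "(\<lambda>n. LINT x|lborel. f x * of_real (cos (s n * x))) \<longlonglongrightarrow> (LINT x|lborel. f x * of_real (cos (t * x)))"
    proof (rule integral_dominated_convergence[where w = "\<lambda>x. cmod (f x)"])
      show "AE x in lborel. (\<lambda>n. f x * of_real (cos (s n * x))) \<longlonglongrightarrow> f x * of_real (cos (t * x))"
        by (intro AE_I2 tendsto_intros s)
      show "AE x in lborel. norm (f x * of_real (cos (s n * x))) \<le> cmod (f x)" for n
        using cmod_mult_cos_le by (intro AE_I2)
    qed (use f in auto)
  qed
qed

section \<open>Every character is a cosine transform\<close>

lemma has_vector_derivative_withinI_quadratic:
  fixes f :: "real \<Rightarrow> 'a::real_normed_vector"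
  assumes "\<And>x. x \<in> S \<Longrightarrow> norm (f x - f y - (x - y) *\<^sub>R f') \<le> K * (x - y)\<^sup>2"
  shows "(f has_vector_derivative f') (at y within S)"
  unfolding has_vector_derivative_def has_derivative_within_alt
proof (intro conjI allI impI bounded_linear_scaleR_left)
  fix e :: real
  assume "0 < e"
  define d where "d = e / (\<bar>K\<bar> + 1)"
  have "d > 0"
    using \<open>0 < e\<close> by (simp add: d_def add_nonneg_pos)
  have "norm (f x - f y - (x - y) *\<^sub>R f') \<le> e * norm (x - y)" if "x \<in> S" "norm (x - y) < d" for x
  proof -
    have "K * (x - y)\<^sup>2 \<le> (\<bar>K\<bar> + 1) * (x - y)\<^sup>2"
      by (intro mult_right_mono) auto
    also have "\<dots> = (\<bar>K\<bar> + 1) * \<bar>x - y\<bar> * \<bar>x - y\<bar>"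
      by (simp add: power2_eq_square)
    also have "\<dots> \<le> e * \<bar>x - y\<bar>"
      using that(2) by (intro mult_right_mono) (auto simp: d_def field_simps)
    finally show ?thesis
      using assms[OF that(1)] by simp
  qed
  with \<open>d > 0\<close> show "\<exists>d>0. \<forall>x\<in>S. norm (x - y) < d \<longrightarrow> norm (f x - f y - (x - y) *\<^sub>R f') \<le> e * norm (x - y)"
    by blast
qed

text \<open>By the estimate, $x \mapsto m(1_{(c,x]})$ is differentiable with derivative $\cos (t x)$. The fundamental
theorem of calculus identifies $m$ with the cosine transform on indicators of intervals, and hence
everywhere.\<close>

lemma L1_dual_eq_cos_transform_if_interval_estimate:
  assumes m: "m \<in> L1_dual"
    and est: "\<And>c d y. c \<le> y \<Longrightarrow> y \<le> d \<Longrightarrow>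
      cmod (m (abs_L1 (indicator {c<..d})) - of_real (d - c) * of_real (cos (t * y))) \<le> K * (d - c)\<^sup>2"
  shows "m = cos_transform t"
proof -
  have "m (abs_L1 (indicator {c<..d})) = cos_transform t (abs_L1 (indicator {c<..d}))" if "c \<le> d" for c d
  proof -
    define F where "F x = m (abs_L1 (indicator {c<..x}))" for x
    have F_diff: "F v - F u = m (abs_L1 (indicator {u<..v}))" if "c \<le> u" "u \<le> v" for u v
    proof -
      have "indicator {u<..v} = (\<lambda>x. indicator {c<..v} x - indicator {c<..u} x :: complex)"
        using that by (auto simp: indicator_def fun_eq_iff)
      then have "abs_L1 (indicator {u<..v}) = abs_L1 (indicator {c<..v}) - abs_L1 (indicator {c<..u})"
        by (simp add: abs_L1_diff)
      then show ?thesis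
        by (simp add: F_def L1_dual_diff[OF m])
    qed
    have deriv: "(F has_vector_derivative of_real (cos (t * y))) (at y within {c..d})" if "c \<le> y" "y \<le> d" for y
    proof (rule has_vector_derivative_withinI_quadratic)
      fix x
      assume x: "x \<in> {c..d}"
      show "norm (F x - F y - (x - y) *\<^sub>R of_real (cos (t * y))) \<le> K * (x - y)\<^sup>2"
      proof (cases "y \<le> x")
        case True
        then show ?thesis
          using est[of y y x] F_diff[of y x] that by (simp add: scaleR_conv_of_real)
      next
        case False
        have "norm (F x - F y - (x - y) *\<^sub>R of_real (cos (t * y))) =
            norm (F y - F x - of_real (y - x) * of_real (cos (t * y)))"
          by (subst norm_minus_cancel[symmetric]) (simp add: scaleR_conv_of_real algebra_simps)
        also have "\<dots> \<le> K * (y - x)\<^sup>2"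
          using est[of x y y] F_diff[of x y] False x by simp
        finally show ?thesis
          by (simp add: power2_commute)
      qed
    qed
    have "(LINT x|lborel. indicator {c..d} x *\<^sub>R complex_of_real (cos (t * x))) = F d - F c"
      using \<open>c \<le> d\<close> deriv by (rule integral_FTC_atLeastAtMost) (auto intro!: continuous_intros)
    moreover have "(LINT x|lborel. indicator {c..d} x *\<^sub>R complex_of_real (cos (t * x))) =
        (LINT x|lborel. indicator {c<..d} x * complex_of_real (cos (t * x)))"
    proof (rule integral_cong_AE)
      show "AE x in lborel. indicator {c..d} x *\<^sub>R complex_of_real (cos (t * x)) =
          indicator {c<..d} x * complex_of_real (cos (t * x))"
        using AE_lborel_singleton[of c] by eventually_elim (auto simp: indicator_def)
    qed auto
    ultimately show ?thesis
      using F_diff[of c d] \<open>c \<le> d\<close> by (simp add: cos_transform_abs_L1)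
  qed
  then have "(\<lambda>F. m F - cos_transform t F) F = 0" for F
    using L1_dual_eq_0[OF L1_dual_minus[OF m cos_transform_in_L1_dual], of t F] by simp
  then show ?thesis
    by (intro ext) (simp only: right_minus_eq)
qed

text \<open>Choose the indicator $I$ of an interval with $m(I) \<noteq> 0$. The exchange law for symmetrized translations
gives $m(A_y f)\, m(I) = m(f)\, m(A_y I)$, where $A_y$ is the symmetrized translation by $y$, so every
$A_y$ acts on $m$ as multiplication by the scalar $\<phi>(y) = m(A_y I) / m(I)$. The composition rule
$A_y A_x = (A_{x+y} + A_{x-y})/2$ then becomes d'Alembert's equation for $\<phi>$, which is
bounded and Lipschitz because $y \mapsto A_y I$ is. Hence $\<phi>(y) = \cos (t y)$, and applying $m$ to the
approximation of $1_{(u,v]} \star_c I$ shows that $m$ maps $1_{(u,v]}$ to $(v - u) \<phi>(y)$ up to a quadratic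
error.\<close>

proposition cosine_spectrum_cases:
  assumes "m \<in> cosine_spectrum"
  obtains t where "t \<ge> 0" "m = cos_transform t"
proof -
  have m: "m \<in> L1_dual" and "m \<noteq> (\<lambda>_. 0)" and mult: "\<And>F G. m (F \<star>\<^sub>c G) = m F * m G"
    using assms by (auto simp: cosine_spectrum_def)
  obtain a b where "m (abs_L1 (indicator {a<..b})) \<noteq> 0"
    using L1_dual_eq_0[OF m] \<open>m \<noteq> (\<lambda>_. 0)\<close> by blast
  define I :: "real \<Rightarrow> complex" where "I = indicator {a<..b}"
  define c where "c = m (abs_L1 I)"
  have "c \<noteq> 0"
    using \<open>m (abs_L1 (indicator {a<..b})) \<noteq> 0\<close> by (simp add: c_def I_def)
  have I: "integrable lborel I" "\<And>x. cmod (I x) \<le> 1"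
    by (simp_all add: I_def indicator_def)
  obtain B where B: "B > 0" "\<And>F. cmod (m F) \<le> B * norm F"
    using L1_dual_bounded[OF m] by metis
  define \<phi> where "\<phi> y = m (abs_L1 (sym_shift y I)) / c" for y
  have shift: "m (abs_L1 (sym_shift y f)) = \<phi> y * m (abs_L1 f)" if "integrable lborel f" for y f
  proof -
    have "m (abs_L1 (sym_shift y f)) * c = m (abs_L1 f) * m (abs_L1 (sym_shift y I))"
      using cosine_conv_sym_shift[OF that I, of y] by (simp add: c_def flip: mult)
    then show ?thesis
      using \<open>c \<noteq> 0\<close> by (simp add: \<phi>_def field_simps)
  qed
  have int_shift: "integrable lborel (sym_shift y I)" for y
    by (rule integrable_sym_shift[OF I(1)])
  have shift_I: "m (abs_L1 (sym_shift y I)) = \<phi> y * c" for y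
    using \<open>c \<noteq> 0\<close> by (simp add: \<phi>_def)
  have "\<phi> (x + y) + \<phi> (x - y) = 2 * \<phi> x * \<phi> y" for x y
  proof -
    have "abs_L1 (sym_shift y (sym_shift x I)) = scaleC_L1 (1 / 2) (abs_L1 (sym_shift (x + y) I) + abs_L1 (sym_shift (x - y) I))"
      using int_shift by (simp add: abs_L1_add abs_L1_scaleC sym_shift_sym_shift)
    then have "\<phi> y * (\<phi> x * c) = (\<phi> (x + y) * c + \<phi> (x - y) * c) / 2"
      using shift[OF int_shift, of y x] by (simp add: L1_dual_scaleC[OF m] L1_dual_add[OF m] shift_I)
    then have "c * (\<phi> (x + y) + \<phi> (x - y)) = c * (2 * \<phi> x * \<phi> y)"
      by (simp add: field_simps)
    then show ?thesis
      using \<open>c \<noteq> 0\<close> mult_left_cancel by blast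
  qed
  moreover have "\<phi> 0 = 1"
    using \<open>c \<noteq> 0\<close> by (simp add: \<phi>_def c_def sym_shift_def[abs_def])
  moreover have "continuous_on UNIV \<phi>"
  proof (rule lipschitz_on_continuous_on)
    show "(B * 2 / cmod c)-lipschitz_on UNIV \<phi>"
    proof (rule lipschitz_onI)
      fix x y :: real
      have "cmod (\<phi> x - \<phi> y) * cmod c = cmod (m (abs_L1 (sym_shift x I) - abs_L1 (sym_shift y I)))"
        by (simp add: L1_dual_diff[OF m] shift_I flip: norm_mult left_diff_distrib)
      also have "\<dots> \<le> B * norm (abs_L1 (sym_shift x I) - abs_L1 (sym_shift y I))"
        by (rule B)
      also have "\<dots> \<le> B * (2 * \<bar>x - y\<bar>)"
        using norm_sym_shift_indicator_Lipschitz B(1) unfolding I_def by (intro mult_left_mono) auto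
      finally show "dist (\<phi> x) (\<phi> y) \<le> B * 2 / cmod c * dist x y"
        using \<open>c \<noteq> 0\<close> by (simp add: dist_norm field_simps)
    qed (use B(1) in simp)
  qed
  moreover have "cmod (\<phi> y) \<le> B * norm (abs_L1 I) / cmod c" for y
  proof -
    have "cmod (m (abs_L1 (sym_shift y I))) \<le> B * norm (abs_L1 I)"
      using B(1) by (intro order_trans[OF B(2)] mult_left_mono norm_sym_shift_le I(1)) auto
    then show ?thesis
      by (simp add: \<phi>_def norm_divide divide_right_mono)
  qed
  ultimately obtain t where "t \<ge> 0" and t: "\<And>x. \<phi> x = of_real (cos (t * x))"
    using bounded_dAlembert_solution_is_cos by metis
  have "cmod (m (abs_L1 (indicator {u<..v})) - of_real (v - u) * of_real (cos (t * y))) \<le> (B * 2 / cmod c) * (v - u)\<^sup>2"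
    if "u \<le> y" "y \<le> v" for u v y
  proof -
    let ?D = "abs_L1 (indicator {u<..v}) \<star>\<^sub>c abs_L1 I - scaleC_L1 (of_real (v - u)) (abs_L1 (sym_shift y I))"
    have "cmod (m (abs_L1 (indicator {u<..v})) - of_real (v - u) * \<phi> y) * cmod c = cmod (m ?D)"
      unfolding norm_mult[symmetric]
      by (simp add: L1_dual_diff[OF m] L1_dual_scaleC[OF m] mult shift_I left_diff_distrib mult.assoc flip: c_def)
    also have "\<dots> \<le> B * norm ?D"
      by (rule B)
    also have "\<dots> \<le> B * (2 * (v - u)\<^sup>2)"
      using norm_cosine_conv_indicator_approx[OF that] B(1) unfolding I_def by (intro mult_left_mono) auto
    finally show ?thesis
      using \<open>c \<noteq> 0\<close> by (simp add: t field_simps)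
  qed
  then have "m = cos_transform t"
    by (rule L1_dual_eq_cos_transform_if_interval_estimate[OF m])
  with \<open>t \<ge> 0\<close> show thesis
    by (rule that)
qed

section \<open>The weak* topology\<close>

lemma continuous_map_L1_weak_star_evaluation: "continuous_map L1_weak_star euclidean (\<lambda>m. m F)"
  unfolding continuous_map_def topspace_L1_weak_star
  by (auto simp: L1_weak_star_def intro!: topology_generated_by_Basis)

lemma continuous_map_into_L1_weak_star:
  assumes "\<And>x. x \<in> topspace X \<Longrightarrow> h x \<in> L1_dual"
    and "\<And>F. continuous_map X euclidean (\<lambda>x. h x F)"
  shows "continuous_map X L1_weak_star h"
  unfolding L1_weak_star_def
proof (rule continuous_on_generated_topo)
  show "h ` topspace X \<subseteq> \<Union> {{m \<in> L1_dual. m F \<in> U} |F U. open U}"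
  proof
    fix m
    assume "m \<in> h ` topspace X"
    then have "m \<in> {m \<in> L1_dual. m 0 \<in> UNIV}"
      using assms(1) by auto
    then show "m \<in> \<Union> {{m \<in> L1_dual. m F \<in> U} |F U. open U}"
      using open_UNIV by blast
  qed
next
  fix W
  assume "W \<in> {{m \<in> L1_dual. m F \<in> U} |F U. open U}"
  then obtain F U where W: "W = {m \<in> L1_dual. m F \<in> U}" and "open U"
    by auto
  have "h -` W \<inter> topspace X = {x \<in> topspace X. h x F \<in> U}"
    using assms(1) by (auto simp: W)
  then show "openin X (h -` W \<inter> topspace X)"
    using assms(2)[of F] \<open>open U\<close> by (simp add: continuous_map_def)
qed

theorem theorem11:
  shows "subtopology L1_weak_star cosine_spectrum homeomorphic_space top_of_set {0::real..}"
proof -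
  \<comment> \<open>The solution $t$ of the equation $m(e) = 1/(1+t^2)$ for the one-sided exponential $e$.\<close>
  define param where "param m = sqrt (1 / Re (m one_sided_exp) - 1)" for m :: "L1 \<Rightarrow> complex"
  have pos: "1 + t\<^sup>2 > 0" for t :: real
    by (simp add: add_pos_nonneg)
  have param: "param (cos_transform t) = t" if "t \<ge> 0" for t
    using that unfolding param_def cos_transform_one_sided_exp Re_complex_of_real by simp
  have topspace: "topspace (subtopology L1_weak_star cosine_spectrum) = cosine_spectrum"
    by (auto simp: cosine_spectrum_def)
  have "homeomorphic_maps (subtopology L1_weak_star cosine_spectrum) (top_of_set {0..}) param cos_transform"
    unfolding homeomorphic_maps_def topspace
  proof (intro conjI ballI)
    have Re: "continuous_map (subtopology L1_weak_star cosine_spectrum) euclideanreal (\<lambda>m. Re (m one_sided_exp))"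
      using continuous_map_compose[OF continuous_map_from_subtopology[OF continuous_map_L1_weak_star_evaluation],
          of euclidean Re] continuous_on_Re[OF continuous_on_id]
      by (simp add: o_def)
    have nonzero: "Re (m one_sided_exp) \<noteq> 0" if "m \<in> cosine_spectrum" for m
      using cosine_spectrum_cases[OF that] pos
      by (metis Re_complex_of_real cos_transform_one_sided_exp divide_eq_0_iff less_irrefl one_neq_zero)
    have "continuous_map (subtopology L1_weak_star cosine_spectrum) euclideanreal param"
      unfolding param_def
      by (intro continuous_map_sqrt continuous_map_diff continuous_map_real_divide continuous_map_const[THEN iffD2] Re)
         (use nonzero topspace in auto)
    moreover have "param m \<ge> 0" if "m \<in> cosine_spectrum" for m
      using cosine_spectrum_cases[OF that] param by metis
    ultimately show "continuous_map (subtopology L1_weak_star cosine_spectrum) (top_of_set {0..}) param"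
      by (auto simp: continuous_map_in_subtopology topspace)
    have "continuous_map (top_of_set {0..}) L1_weak_star cos_transform"
    proof (rule continuous_map_into_L1_weak_star)
      show "continuous_map (top_of_set {0..}) euclidean (\<lambda>t. cos_transform t F)" for F
        by (simp add: continuous_at_imp_continuous_on isCont_cos_transform)
    qed (rule cos_transform_in_L1_dual)
    then show "continuous_map (top_of_set {0..}) (subtopology L1_weak_star cosine_spectrum) cos_transform"
      by (auto simp: continuous_map_in_subtopology cos_transform_in_cosine_spectrum)
    show "cos_transform (param m) = m" if "m \<in> cosine_spectrum" for m
      using cosine_spectrum_cases[OF that] param by metis
    show "param (cos_transform t) = t" if "t \<in> topspace (top_of_set {0..})" for t
      using that param by simp
  qed
  then show ?thesis
    by (auto simp: homeomorphic_space_def)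
qed

end
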